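(* Let $\Omega\subset\mathbb{C}$ be a bounded domain such that $\partial\Omega$ has no isolated points. Assume that there exist rational holomorphic functions $f,g\in\mathbb{C}(z)$ and a rational harmonic function $r$, not all $0$, such that $$r^4-2(f+\bar{g})r^2+(f-\bar{g})^2=0\quad\text{on }\partial\Omega .$$ Then the Khavinson-Shapiro conjecture holds for $\Omega$: if for every polynomial $p\in\mathbb{C}[z,\bar z]$ the solution of the Dirichlet problem on $\Omega$ with boundary data $p|_{\partial\Omega}$ is again a polynomial, then $\Omega$ must be an ellipse.
   Context: A rational harmonic function is an element of $\mathbb{C}(z)+\mathbb{C}(\bar z)$, i.e. a function of the form $a(z)+b(\bar z)$ with $a,b$ rational functions of one variable over $\mathbb{C}$. Here $\bar g$ denotes the function $z\mapsto\overline{g(z)}$. Solving the Dirichlet problem on $\Omega$ with boundary data $v\in C(\partial\Omega)$ means finding $u\in C^2(\Omega)\cap C(\overline{\Omega})$ that is harmonic on $\Omega$ and satisfies $u|_{\partial\Omega}=v$. "$\Omega$ is an ellipse" means that $\Omega$ is the bounded region enclosed by an ellipse (discs included). *)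

theory Defs
  imports
    "HOL-Analysis.Analysis"
    "HOL-Computational_Algebra.Polynomial_Factorial"
    "HOL-Computational_Algebra.Field_as_Ring"
begin

(* An element of C(z) is evaluated through its reduced fraction; at a pole the value is the
   junk value 0, so every use below is guarded by rat_poles. *)

definition rat_eval :: "complex poly fract \<Rightarrow> complex \<Rightarrow> complex" where
  "rat_eval f z = poly (fst (quot_of_fract f)) z / poly (snd (quot_of_fract f)) z"

definition rat_poles :: "complex poly fract \<Rightarrow> complex set" where
  "rat_poles f = {z. poly (snd (quot_of_fract f)) z = 0}"

(* A rational harmonic function a(z) + b(cnj z) is represented by a pair (a, b) of elements of
   C(z). The pair is unique up to moving a constant between a and b, which changes neither the
   values nor the poles. The polar parts of a(z) and b(cnj z) never cancel: even at a common
   pole the sum has no finite limit, hence the union in the second definition. *)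

definition rat_harm_eval :: "complex poly fract \<times> complex poly fract \<Rightarrow> complex \<Rightarrow> complex" where
  "rat_harm_eval r z = rat_eval (fst r) z + rat_eval (snd r) (cnj z)"

definition rat_harm_poles :: "complex poly fract \<times> complex poly fract \<Rightarrow> complex set" where
  "rat_harm_poles r = rat_poles (fst r) \<union> {z. cnj z \<in> rat_poles (snd r)}"

definition rat_harm_zero :: "complex poly fract \<times> complex poly fract \<Rightarrow> bool" where
  "rat_harm_zero r \<longleftrightarrow> (\<forall>z. z \<notin> rat_harm_poles r \<longrightarrow> rat_harm_eval r z = 0)"

(* P stands for a polynomial in cnj z whose coefficients are polynomials in z. *)

definition zzbar_poly :: "complex poly poly \<Rightarrow> complex \<Rightarrow> complex" where
  "zzbar_poly P z = poly (poly P [:cnj z:]) z"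

(* For d = 1 and d = \<i> these are the partial derivatives in x and y, where z = x + \<i> y. *)

definition has_partial :: "complex \<Rightarrow> (complex \<Rightarrow> complex) \<Rightarrow> complex \<Rightarrow> bool" where
  "has_partial d u z \<longleftrightarrow> (\<lambda>t::real. u (z + of_real t * d)) differentiable (at 0)"

definition partial :: "complex \<Rightarrow> (complex \<Rightarrow> complex) \<Rightarrow> complex \<Rightarrow> complex" where
  "partial d u z = vector_derivative (\<lambda>t::real. u (z + of_real t * d)) (at 0)"

(* Continuous differentiability on an open set. *)

definition C1_on :: "complex set \<Rightarrow> (complex \<Rightarrow> complex) \<Rightarrow> bool" where
  "C1_on S u \<longleftrightarrow>
     (\<forall>d\<in>{1, \<i>}. (\<forall>z\<in>S. has_partial d u z) \<and> continuous_on S (partial d u))"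

definition C2_on :: "complex set \<Rightarrow> (complex \<Rightarrow> complex) \<Rightarrow> bool" where
  "C2_on S u \<longleftrightarrow> C1_on S u \<and> (\<forall>d\<in>{1, \<i>}. C1_on S (partial d u))"

definition laplacian :: "(complex \<Rightarrow> complex) \<Rightarrow> complex \<Rightarrow> complex" where
  "laplacian u z = partial 1 (partial 1 u) z + partial \<i> (partial \<i> u) z"

definition dirichlet_solution ::
  "complex set \<Rightarrow> (complex \<Rightarrow> complex) \<Rightarrow> (complex \<Rightarrow> complex) \<Rightarrow> bool" where
  "dirichlet_solution \<Omega> v u \<longleftrightarrow>
     C2_on \<Omega> u \<and> continuous_on (closure \<Omega>) u \<and>
     (\<forall>z\<in>\<Omega>. laplacian u z = 0) \<and> (\<forall>z\<in>frontier \<Omega>. u z = v z)"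

(* Open region with centre c, semi-axes a and b, rotated by the angle t. *)

definition ellipse_region :: "complex \<Rightarrow> real \<Rightarrow> real \<Rightarrow> real \<Rightarrow> complex set" where
  "ellipse_region c t a b = {c + cis t * Complex x y |x y. (x / a)\<^sup>2 + (y / b)\<^sup>2 < 1}"

definition is_ellipse :: "complex set \<Rightarrow> bool" where
  "is_ellipse \<Omega> \<longleftrightarrow> (\<exists>c t a b. a > 0 \<and> b > 0 \<and> \<Omega> = ellipse_region c t a b)"

definition khavinson_shapiro :: "complex set \<Rightarrow> bool" where
  "khavinson_shapiro \<Omega> \<longleftrightarrow>
     ((\<forall>P. \<exists>u. dirichlet_solution \<Omega> (zzbar_poly P) u \<and>
               (\<exists>Q. \<forall>z\<in>closure \<Omega>. u z = zzbar_poly Q z))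
       \<longrightarrow> is_ellipse \<Omega>)"

end

theory Submission
  imports Defs "HOL-Complex_Analysis.Complex_Analysis"
    "HOL-Computational_Algebra.Fundamental_Theorem_Algebra"
begin

text \<open>
  Polynomial solvability for the datum \<open>|z|\<^sup>2\<close> puts the boundary on the curve \<open>z w = A(z) + B(w)\<close>,
  \<open>w = cnj z\<close>, with \<open>B\<close> the conjugate of \<open>A\<close>. If \<open>n = deg A \<le> 2\<close>, the curve is a conic whose
  quadratic part has positive trace, and a bounded domain with boundary on it is the inside of an
  ellipse. Suppose \<open>n \<ge> 3\<close>. The polynomials in \<open>z, w\<close> vanishing on the boundary form a principal ideal
  \<open>(\<phi>)\<close>, and at infinity \<open>w / z\<close> tends to one of \<open>deg \<phi>\<close> distinct roots \<open>\<omega>\<close> of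
  \<open>\<omega>\<^sup>n = \<rho>\<close> on the branches of \<open>\<phi> = 0\<close>. If there are at most two branches, \<open>\<phi>\<close> is of degree at most
  two in \<open>w\<close> and a harmonic polynomial would vanish on the boundary. If there are at least three,
  consider the datum \<open>z\<^sup>n\<^sup>-\<^sup>1 w = P(z) + Q(w)\<close>. The top terms of \<open>P + Q\<close>, of degree \<open>M > n\<close>, must cancel on
  all branches, which forces \<open>n dvd M\<close>, say \<open>M = n k\<close>. Subtracting a multiple of
  \<open>A\<^sup>k - (- B)\<^sup>k\<close>, which has \<open>A + B = z w\<close> as a factor, leaves a harmonic polynomial with leading
  behaviour \<open>\<gamma> \<omega> z\<^sup>J\<close>, \<open>J = M - n + 2\<close>, \<open>\<gamma> \<noteq> 0\<close>. A harmonic polynomial can only produce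
  \<open>(p + q \<omega>\<^sup>2) z\<^sup>J\<close> there, and \<open>p + q \<omega>\<^sup>2 = \<gamma> \<omega>\<close> has at most two solutions.
\<close>

section \<open>Polynomials\<close>

lemma coeff_mult_le_degree:
  fixes p q :: "'a::comm_semiring_1 poly"
  assumes "degree p \<le> a" "degree q \<le> b"
  shows "coeff (p * q) (a + b) = coeff p a * coeff q b"
proof -
  have "coeff (p * q) (a + b) = (\<Sum>i\<le>a + b. coeff p i * coeff q (a + b - i))"
    by (simp add: coeff_mult)
  also have "\<dots> = (\<Sum>i\<in>{a}. coeff p i * coeff q (a + b - i))"
  proof (rule sum.mono_neutral_right)
    show "\<forall>i\<in>{..a + b} - {a}. coeff p i * coeff q (a + b - i) = 0"
    proof
      fix i assume i: "i \<in> {..a + b} - {a}"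
      show "coeff p i * coeff q (a + b - i) = 0"
      proof (cases "i < a")
        case True
        then have "degree q < a + b - i" using assms by linarith
        then show ?thesis by (simp add: coeff_eq_0)
      next
        case False
        then have "degree p < i" using i assms by auto
        then show ?thesis by (simp add: coeff_eq_0)
      qed
    qed
  qed auto
  finally show ?thesis by simp
qed

lemma degree_power_le':
  fixes p :: "'a::comm_semiring_1 poly"
  assumes "degree p \<le> a"
  shows "degree (p ^ k) \<le> a * k"
  using degree_power_le[of p k] mult_right_mono[OF assms, of k] by linarith

lemma coeff_power_le_degree:
  fixes p :: "'a::comm_semiring_1 poly"
  assumes "degree p \<le> a"
  shows "coeff (p ^ k) (a * k) = coeff p a ^ k"
proof (induction k)
  case (Suc k)
  show ?case
    using coeff_mult_le_degree[OF assms degree_power_le'[OF assms, of k]] Suc by simp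
qed simp

lemma power_diff_eq_mult_sum:
  fixes x y :: "'a::comm_ring_1"
  assumes "m > 0"
  shows "x ^ m - y ^ m = (x - y) * (\<Sum>i<m. x ^ i * y ^ (m - Suc i))"
  using assms diff_power_eq_sum[of x "m - 1" y] by (cases m) auto

text \<open>Adding \<open>monom a k\<close> to \<open>U\<close> with \<open>k = e - Suc j\<close>
  leaves the coefficients of \<open>U ^ m\<close> above degree \<open>e * m - Suc j\<close> alone
  and changes that one by \<open>of_nat m * u ^ (m - 1) * a\<close>, so \<open>a\<close> can be
  chosen to clear it in \<open>A - U ^ m\<close>.\<close>

lemma approximate_root_step:
  fixes A U :: "complex poly"
  assumes "m > 0" "e > j" "u \<noteq> 0"
    and U: "degree U \<le> e" "coeff U e = u"
    and low: "\<And>i. i \<ge> e * m - j \<Longrightarrow> coeff (A - U ^ m) i = 0"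
  shows "\<exists>V. degree V \<le> e \<and> coeff V e = u \<and> (\<forall>i\<ge>e * m - Suc j. coeff (A - V ^ m) i = 0)"
proof -
  define k where "k = e - Suc j"
  define a where "a = coeff (A - U ^ m) (k + e * (m - 1)) / (of_nat m * u ^ (m - 1))"
  define V where "V = U + monom a k"
  have ke: "k < e" using assms(2) by (simp add: k_def)
  have V: "degree V \<le> e" "coeff V e = u"
    using U ke degree_monom_le[of a k] unfolding V_def by (auto intro!: degree_add_le)
  define T where "T = (\<Sum>i<m. V ^ i * U ^ (m - Suc i))"
  have e: "e * i + e * (m - Suc i) = e * (m - 1)" if "i < m" for i
    using that by (simp flip: distrib_left)
  have degT: "degree T \<le> e * (m - 1)"
    unfolding T_def
  proof (intro degree_sum_le)
    fix i assume "i \<in> {..<m}"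
    then show "degree (V ^ i * U ^ (m - Suc i)) \<le> e * (m - 1)"
      using degree_mult_le[of "V ^ i" "U ^ (m - Suc i)"] degree_power_le'[OF V(1), of i]
        degree_power_le'[OF U(1), of "m - Suc i"] e[of i] by auto
  qed auto
  have "coeff (V ^ i * U ^ (m - Suc i)) (e * (m - 1)) = u ^ (m - 1)" if "i < m" for i
    using coeff_mult_le_degree[OF degree_power_le'[OF V(1)] degree_power_le'[OF U(1)], of i "m - Suc i"]
      that V(2) U(2) e[OF that] by (simp add: coeff_power_le_degree[OF V(1)] coeff_power_le_degree[OF U(1)] flip: power_add)
  then have cT: "coeff T (e * (m - 1)) = of_nat m * u ^ (m - 1)"
    by (simp add: T_def coeff_sum)
  have VU: "V ^ m - U ^ m = monom a k * T"
    using power_diff_eq_mult_sum[OF \<open>m > 0\<close>, of V U] by (simp add: T_def V_def)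
  have N: "e * m - Suc j = k + e * (m - 1)"
    using assms(1,2) by (cases m) (auto simp: k_def)
  have "coeff (A - V ^ m) i = 0" if i: "i \<ge> e * m - Suc j" for i
  proof (cases "i = e * m - Suc j")
    case True
    have "coeff (V ^ m - U ^ m) i = coeff (A - U ^ m) i"
      unfolding VU True N using coeff_mult_le_degree[OF degree_monom_le degT, of a k] cT assms(1,3)
      by (simp add: a_def)
    then show ?thesis by simp
  next
    case False
    then have "i \<ge> e * m - j" using i by linarith
    moreover have "degree (monom a k * T) < i"
      using degree_mult_le[of "monom a k" T] degree_monom_le[of a k] degT i False N by linarith
    ultimately have "coeff (V ^ m - U ^ m) i = 0" "coeff (A - U ^ m) i = 0"
      unfolding VU using low by (simp_all add: coeff_eq_0)
    then show ?thesis by simp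
  qed
  then show ?thesis using V by blast
qed

text \<open>\<open>U\<close> is the polynomial part of an \<open>m\<close>-th root of
  \<open>A\<close> at infinity. Starting from \<open>monom u e\<close>, each of \<open>e\<close>
  steps clears one more coefficient; the last one adjusts the constant term of
  \<open>U\<close>.\<close>

lemma approximate_root:
  fixes A :: "complex poly"
  assumes "m > 0" "degree A \<le> e * m" "u ^ m = coeff A (e * m)" "u \<noteq> 0"
  shows "\<exists>U. degree U \<le> e \<and> coeff U e = u \<and> (\<forall>i\<ge>e * m - e. coeff (A - U ^ m) i = 0)"
proof -
  have "\<exists>U. degree U \<le> e \<and> coeff U e = u \<and> (\<forall>i\<ge>e * m - j. coeff (A - U ^ m) i = 0)"
    if "j \<le> e" for j
    using that
  proof (induction j)
    case 0
    have "coeff (A - monom u e ^ m) i = 0" if "i \<ge> e * m" for i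
      using that assms(2,3) by (auto simp: monom_power coeff_monom coeff_eq_0)
    then show ?case by (intro exI[of _ "monom u e"]) (auto simp: degree_monom_le)
  next
    case (Suc j)
    then show ?case using approximate_root_step[OF assms(1) _ assms(4), of j e _ A] by auto
  qed
  then show ?thesis by blast
qed

lemma poly_over_power_tendsto:
  fixes p :: "complex poly"
  assumes "degree p \<le> N" "filterlim Z at_infinity F"
  shows "((\<lambda>j. poly p (Z j) / Z j ^ N) \<longlongrightarrow> coeff p N) F"
proof -
  have ev: "eventually (\<lambda>j. Z j \<noteq> 0) F"
    using assms(2) by (simp add: filterlim_at_infinity_imp_eventually_ne)
  have "((\<lambda>j. coeff p i * (inverse (Z j)) ^ (N - i)) \<longlongrightarrow> coeff p i * 0 ^ (N - i)) F" for i
    by (intro tendsto_intros filterlim_compose[OF tendsto_inverse_0 assms(2)])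
  then have "((\<lambda>j. \<Sum>i\<le>N. coeff p i * (inverse (Z j)) ^ (N - i)) \<longlongrightarrow> (\<Sum>i\<le>N. coeff p i * 0 ^ (N - i))) F"
    by (intro tendsto_sum)
  also have "(\<Sum>i\<le>N. coeff p i * 0 ^ (N - i)) = (\<Sum>i\<in>{N}. coeff p i * 0 ^ (N - i))"
    by (rule sum.mono_neutral_right) auto
  finally have "((\<lambda>j. \<Sum>i\<le>N. coeff p i * (inverse (Z j)) ^ (N - i)) \<longlongrightarrow> coeff p N) F" by simp
  then show ?thesis
  proof (rule Lim_transform_eventually)
    show "eventually (\<lambda>j. (\<Sum>i\<le>N. coeff p i * (inverse (Z j)) ^ (N - i)) = poly p (Z j) / Z j ^ N) F"
      using ev
    proof eventually_elim
      case (elim j)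
      have "poly p (Z j) = (\<Sum>i\<le>N. coeff p i * Z j ^ i)"
        using assms(1) unfolding poly_altdef
        by (intro sum.mono_neutral_left) (auto simp: coeff_eq_0)
      then show ?case
        using elim by (auto simp: sum_divide_distrib power_diff field_simps intro!: sum.cong)
    qed
  qed
qed

text \<open>The modulus of \<open>p\<close> at \<open>a\<close> is that of the leading coefficient
  times the product of the distances to the roots. The induction splits off one root and keeps the
  nearer of two candidates.\<close>

lemma root_near:
  fixes p :: "complex poly"
  assumes "degree p = n" "n > 0"
  shows "\<exists>r. poly p r = 0 \<and> norm (lead_coeff p) * norm (a - r) ^ n \<le> norm (poly p a)"
  using assms
proof (induction n arbitrary: p)
  case (Suc n)
  have "\<not> constant (poly p)" using Suc.prems by (simp add: constant_degree)
  then obtain r0 where r0: "poly p r0 = 0"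
    using fundamental_theorem_of_algebra by blast
  then obtain q where q: "p = [:-r0, 1:] * q" by (auto simp: poly_eq_0_iff_dvd elim: dvdE)
  then have "q \<noteq> 0" using Suc.prems by auto
  then have "degree p = 1 + degree q" unfolding q by (subst degree_mult_eq) auto
  then have dq: "degree q = n" using Suc.prems by simp
  have lc: "lead_coeff p = lead_coeff q" using q by (simp add: lead_coeff_mult del: mult_pCons_left)
  have pa: "norm (poly p a) = norm (a - r0) * norm (poly q a)"
    by (simp add: q norm_mult[symmetric] algebra_simps)
  show ?case
  proof (cases "n = 0")
    case True
    then obtain c where "q = [:c:]" using dq degree_eq_zeroE by blast
    then show ?thesis using r0 pa lc True by (intro exI[of _ r0]) (simp add: mult.commute)
  next
    case False
    then obtain r where r: "poly q r = 0" "norm (lead_coeff q) * norm (a - r) ^ n \<le> norm (poly q a)"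
      using Suc.IH dq by blast
    show ?thesis
    proof (cases "norm (a - r) \<le> norm (a - r0)")
      case True
      have "norm (a - r) * (norm (lead_coeff q) * norm (a - r) ^ n) \<le> norm (a - r0) * norm (poly q a)"
        by (intro mult_mono True r(2)) auto
      then show ?thesis using r(1) pa lc by (intro exI[of _ r]) (simp add: q ac_simps)
    next
      case False
      then have "norm (lead_coeff q) * norm (a - r0) ^ n \<le> norm (lead_coeff q) * norm (a - r) ^ n"
        by (intro mult_left_mono power_mono) auto
      then have "norm (a - r0) * (norm (lead_coeff q) * norm (a - r0) ^ n) \<le> norm (a - r0) * norm (poly q a)"
        using r(2) by (intro mult_left_mono) auto
      then show ?thesis using r0 pa lc by (intro exI[of _ r0]) (simp add: ac_simps)
    qed
  qed
qed simp

section \<open>Harmonic polynomials along the branches at infinity\<close>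

lemma power_gcd_eq_1:
  fixes x :: "'a::monoid_mult"
  assumes "x ^ m = 1" "x ^ n = 1"
  shows "x ^ gcd m n = 1"
proof (cases "m = 0")
  case False
  then obtain a b where "m * a = n * b + gcd m n" using bezout_nat by blast
  then have "x ^ (m * a) = x ^ (n * b) * x ^ gcd m n" by (simp add: power_add)
  then show ?thesis using assms by (simp add: power_mult)
qed (use assms in simp)

lemma degree_lessI_coeff:
  assumes "degree p \<le> M" "coeff p M = 0" "M > 0"
  shows "degree p < M"
proof (rule ccontr)
  assume "\<not> degree p < M"
  then have "degree p = M" using assms(1) by simp
  then show False using assms(2,3) by (metis degree_0 leading_coeff_0_iff less_irrefl)
qed

text \<open>Branches \<open>W \<omega>\<close> of the curve \<open>z w = A(z) + B(w)\<close> over a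
  sequence \<open>Z\<close> tending to infinity. Indexing a branch by its limiting slope makes the
  slopes distinct; sequences take the place of Puiseux expansions.\<close>

locale curve_branches =
  fixes S :: "complex set" and Z :: "nat \<Rightarrow> complex" and W :: "complex \<Rightarrow> nat \<Rightarrow> complex"
    and n :: nat and A B :: "complex poly"
  assumes finite_S: "finite S" and zero_notin_S: "0 \<notin> S"
    and Z_infinity: "filterlim Z at_infinity sequentially"
    and ratio: "\<And>\<omega>. \<omega> \<in> S \<Longrightarrow> (\<lambda>j. W \<omega> j / Z j) \<longlonglongrightarrow> \<omega>"
    and curve: "\<And>\<omega> j. \<omega> \<in> S \<Longrightarrow> Z j * W \<omega> j = poly A (Z j) + poly B (W \<omega> j)"
    and degree_A: "degree A = n" and degree_B: "degree B = n" and n_ge_3: "n \<ge> 3"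
begin

lemma Z_nonzero: "eventually (\<lambda>j. Z j \<noteq> 0) sequentially"
  using Z_infinity by (simp add: filterlim_at_infinity_imp_eventually_ne)

lemma W_infinity: "\<omega> \<in> S \<Longrightarrow> filterlim (W \<omega>) at_infinity sequentially"
proof -
  assume w: "\<omega> \<in> S"
  then have "\<omega> \<noteq> 0" using zero_notin_S by auto
  then have "filterlim (\<lambda>j. W \<omega> j / Z j * Z j) at_infinity sequentially"
    by (intro tendsto_mult_filterlim_at_infinity[OF ratio[OF w]] Z_infinity)
  moreover have "eventually (\<lambda>j. W \<omega> j / Z j * Z j = W \<omega> j) sequentially"
    using Z_nonzero by eventually_elim auto
  ultimately show ?thesis using filterlim_cong by fastforce
qed

lemma poly_Z_tendsto:
  "degree p \<le> N \<Longrightarrow> (\<lambda>j. poly p (Z j) / Z j ^ N) \<longlonglongrightarrow> coeff p N"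
  by (rule poly_over_power_tendsto[OF _ Z_infinity])

lemma poly_W_tendsto:
  assumes "\<omega> \<in> S" "degree q \<le> N"
  shows "(\<lambda>j. poly q (W \<omega> j) / Z j ^ N) \<longlonglongrightarrow> coeff q N * \<omega> ^ N"
proof -
  have "(\<lambda>j. poly q (W \<omega> j) / W \<omega> j ^ N * (W \<omega> j / Z j) ^ N) \<longlonglongrightarrow> coeff q N * \<omega> ^ N"
    by (intro tendsto_intros poly_over_power_tendsto[OF assms(2)] W_infinity ratio assms(1))
  moreover have "eventually (\<lambda>j. poly q (W \<omega> j) / W \<omega> j ^ N * (W \<omega> j / Z j) ^ N = poly q (W \<omega> j) / Z j ^ N) sequentially"
    using filterlim_at_infinity_imp_eventually_ne[OF W_infinity[OF assms(1)], of 0]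
    by eventually_elim (auto simp: power_divide)
  ultimately show ?thesis by (rule Lim_transform_eventually)
qed

lemma harmonic_tendsto:
  assumes "\<omega> \<in> S" "degree P \<le> N" "degree Q \<le> N"
  shows "(\<lambda>j. (poly P (Z j) + poly Q (W \<omega> j)) / Z j ^ N) \<longlonglongrightarrow> coeff P N + coeff Q N * \<omega> ^ N"
  unfolding add_divide_distrib
  by (intro tendsto_intros poly_Z_tendsto poly_W_tendsto assms)

lemma monomial_tendsto:
  assumes "\<omega> \<in> S"
  shows "(\<lambda>j. Z j ^ k * W \<omega> j / Z j ^ Suc k) \<longlonglongrightarrow> \<omega>"
  using ratio[OF assms]
  by (rule Lim_transform_eventually, use Z_nonzero in eventually_elim) auto

lemma Z_power_tendsto_0:
  assumes "k > 0"
  shows "(\<lambda>j. 1 / Z j ^ k) \<longlonglongrightarrow> 0"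
  using poly_Z_tendsto[of 1 k] assms by (simp add: coeff_eq_0)

lemma monomial_tendsto_0:
  assumes "\<omega> \<in> S" "N > Suc k"
  shows "(\<lambda>j. Z j ^ k * W \<omega> j / Z j ^ N) \<longlonglongrightarrow> 0"
proof -
  have "(\<lambda>j. Z j ^ k * W \<omega> j / Z j ^ Suc k * (1 / Z j ^ (N - Suc k))) \<longlonglongrightarrow> \<omega> * 0"
    by (intro tendsto_intros monomial_tendsto Z_power_tendsto_0) (use assms in auto)
  moreover have "Z j ^ Suc k * Z j ^ (N - Suc k) = Z j ^ N" for j
    using assms(2) by (simp flip: power_add power_Suc)
  ultimately show ?thesis by (simp only: times_divide_times_eq mult_1_right mult_zero_right)
qed

text \<open>Along a branch \<open>z w\<close> has order 2, below \<open>n\<close>, so the top terms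
  of \<open>A(z)\<close> and \<open>B(w)\<close> must cancel.\<close>

lemma power_n:
  assumes "\<omega> \<in> S"
  shows "\<omega> ^ n = - lead_coeff A / lead_coeff B"
proof -
  have "(\<lambda>j. (poly A (Z j) + poly B (W \<omega> j)) / Z j ^ n) \<longlonglongrightarrow> coeff A n + coeff B n * \<omega> ^ n"
    by (rule harmonic_tendsto) (use assms degree_A degree_B in auto)
  moreover have "(\<lambda>j. (poly A (Z j) + poly B (W \<omega> j)) / Z j ^ n) \<longlonglongrightarrow> 0"
    using monomial_tendsto_0[OF assms, of 1 n] n_ge_3 curve[OF assms] by simp
  ultimately have "coeff A n + coeff B n * \<omega> ^ n = 0"
    using LIMSEQ_unique by blast
  moreover have "lead_coeff B \<noteq> 0" using degree_B n_ge_3 leading_coeff_0_iff[of B] by force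
  ultimately show ?thesis using degree_A degree_B by (simp add: field_simps eq_neg_iff_add_eq_0)
qed

lemma lead_nonzero: "lead_coeff A \<noteq> 0" "lead_coeff B \<noteq> 0"
  using degree_A degree_B n_ge_3 leading_coeff_0_iff[of A] leading_coeff_0_iff[of B] by force+

text \<open>A constant power \<open>\<omega> ^ m\<close> with \<open>n\<close> not dividing \<open>m\<close> makes \<open>\<omega> ^ e\<close> constant for
  \<open>e = gcd m n\<close>, a proper divisor of \<open>n\<close>. Then \<open>U\<close> and \<open>V\<close> are the polynomial parts of the
  \<open>(n / e)\<close>-th roots of \<open>A\<close> and \<open>- B\<close>.\<close>

lemma decaying_harmonic_if_power_constant:
  assumes "card S \<ge> 3" "\<And>\<omega>. \<omega> \<in> S \<Longrightarrow> \<omega> ^ m = \<kappa>" "\<not> n dvd m"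
  shows "\<exists>U V. degree U > 0 \<and> (\<forall>\<omega>\<in>S. (\<lambda>j. poly U (Z j) - poly V (W \<omega> j)) \<longlonglongrightarrow> 0)"
proof -
  define e where "e = gcd m n"
  have "S \<noteq> {}" using assms(1) by auto
  then obtain \<omega>0 where w0: "\<omega>0 \<in> S" by blast
  then have w0nz: "\<omega>0 \<noteq> 0" using zero_notin_S by auto
  have we: "\<omega> ^ e = \<omega>0 ^ e" if "\<omega> \<in> S" for \<omega>
  proof -
    have "\<omega> ^ m = \<omega>0 ^ m" "\<omega> ^ n = \<omega>0 ^ n"
      using assms(2)[OF that] assms(2)[OF w0] power_n[OF that] power_n[OF w0] by metis+
    then have "(\<omega> / \<omega>0) ^ m = 1" "(\<omega> / \<omega>0) ^ n = 1"
      using w0nz by (simp_all add: power_divide)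
    then have "(\<omega> / \<omega>0) ^ e = 1" unfolding e_def by (rule power_gcd_eq_1)
    then show ?thesis using w0nz by (simp add: power_divide)
  qed
  have epos: "e > 0" using n_ge_3 by (simp add: e_def)
  \<comment> \<open>All slopes are among the \<open>e\<close> roots of one equation, so
    \<open>e \<ge> 3\<close>. Then \<open>n - e\<close>, a positive multiple of \<open>e\<close>, is
    at least 3 as well, and \<open>z w\<close> is negligible against
    \<open>Z ^ (n - e)\<close>.\<close>
  have "card S \<le> card {z. z ^ e = \<omega>0 ^ e}"
    by (intro card_mono) (use we epos in auto)
  also have "\<dots> = e" by (intro card_nth_roots) (use w0nz epos in auto)
  finally have e3: "e \<ge> 3" using assms(1) by simp
  obtain m' where m': "n = e * m'" using e_def by (metis dvdE gcd_dvd2)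
  have "e \<noteq> n" using assms(3) e_def by (metis gcd_dvd1)
  then have m'2: "m' \<ge> 2" using m' n_ge_3 by (cases "m' = 0 \<or> m' = 1") auto
  have ne: "n - e = e * (m' - 1)" using m' by (simp add: algebra_simps)
  have ne3: "n - e \<ge> 3" using mult_le_mono2[of 1 "m' - 1" e] e3 m'2 unfolding ne by linarith
  define \<alpha> where "\<alpha> = lead_coeff A"
  define u where "u = exp (Ln \<alpha> / of_nat m')"
  have um: "u ^ m' = \<alpha>" and unz: "u \<noteq> 0"
    using lead_nonzero m'2 by (auto simp: u_def \<alpha>_def simp flip: exp_of_nat_mult)
  \<comment> \<open>Since \<open>\<omega> ^ e\<close> is the same for all slopes, this choice makes
    \<open>V(W)\<close> asymptotic to \<open>u * Z ^ e\<close>, as \<open>U(Z)\<close> is, on every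
    branch at once.\<close>
  define v where "v = u / \<omega>0 ^ e"
  have vw: "v * \<omega> ^ e = u" if "\<omega> \<in> S" for \<omega>
    using we[OF that] w0nz by (simp add: v_def)
  have "v ^ m' = \<alpha> / \<omega>0 ^ n" by (simp add: v_def power_divide um m' power_mult)
  then have vm: "v ^ m' = - lead_coeff B"
    using lead_nonzero by (simp add: power_n[OF w0] \<alpha>_def)
  obtain U where U: "degree U \<le> e" "coeff U e = u" "\<And>i. i \<ge> n - e \<Longrightarrow> coeff (A - U ^ m') i = 0"
    using approximate_root[of m' A e u] um unz m'2 m' degree_A by (auto simp: \<alpha>_def)
  obtain V where V: "degree V \<le> e" "coeff V e = v" "\<And>i. i \<ge> n - e \<Longrightarrow> coeff (- B - V ^ m') i = 0"
    using approximate_root[of m' "- B" e v] vm unz w0nz m'2 m' degree_B by (auto simp: v_def)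
  have "(\<lambda>j. poly U (Z j) - poly V (W \<omega> j)) \<longlonglongrightarrow> 0" if w: "\<omega> \<in> S" for \<omega>
  proof -
    let ?u = "\<lambda>j. poly U (Z j)" and ?v = "\<lambda>j. poly V (W \<omega> j)"
    \<comment> \<open>The cofactor of \<open>U - V\<close> in \<open>U ^ m' - V ^ m'\<close>, scaled
      to have a nonzero limit, so that it can be divided out at the end.\<close>
    define T where "T j = (\<Sum>i<m'. ?u j ^ i * ?v j ^ (m' - Suc i)) / Z j ^ (n - e)" for j
    have "(\<lambda>j. \<Sum>i<m'. poly (U ^ i) (Z j) / Z j ^ (e * i) * (poly (V ^ (m' - Suc i)) (W \<omega> j) / Z j ^ (e * (m' - Suc i))))
        \<longlonglongrightarrow> (\<Sum>i<m'. coeff (U ^ i) (e * i) * (coeff (V ^ (m' - Suc i)) (e * (m' - Suc i)) * \<omega> ^ (e * (m' - Suc i))))"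
      by (intro tendsto_intros poly_Z_tendsto poly_W_tendsto degree_power_le' U(1) V(1) w)
    also have "(\<Sum>i<m'. coeff (U ^ i) (e * i) * (coeff (V ^ (m' - Suc i)) (e * (m' - Suc i)) * \<omega> ^ (e * (m' - Suc i))))
       = (\<Sum>i<m'. u ^ (m' - 1))"
      using vw[OF w] by (intro sum.cong refl) (simp add: coeff_power_le_degree U(1,2) V(1,2) power_mult flip: power_mult_distrib power_add)
    also have "\<dots> = of_nat m' * u ^ (m' - 1)" by simp
    also have "(\<lambda>j. \<Sum>i<m'. poly (U ^ i) (Z j) / Z j ^ (e * i) * (poly (V ^ (m' - Suc i)) (W \<omega> j) / Z j ^ (e * (m' - Suc i)))) = T"
      unfolding T_def sum_divide_distrib ne
      by (intro ext sum.cong refl) (simp flip: power_add distrib_left)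
    finally have T: "T \<longlonglongrightarrow> of_nat m' * u ^ (m' - 1)" .
    \<comment> \<open>On the curve the numerators combine to \<open>U ^ m' - V ^ m'\<close>. The
      approximate roots leave remainders without terms of degree \<open>n - e\<close> or more, so
      the quotient tends to 0.\<close>
    have "(\<lambda>j. (Z j ^ 1 * W \<omega> j) / Z j ^ (n - e) - (poly (A - U ^ m') (Z j) + poly (B + V ^ m') (W \<omega> j)) / Z j ^ (n - e))
        \<longlonglongrightarrow> 0 - (coeff (A - U ^ m') (n - e) + coeff (B + V ^ m') (n - e) * \<omega> ^ (n - e))"
    proof (intro tendsto_diff monomial_tendsto_0 harmonic_tendsto w)
      show "degree (A - U ^ m') \<le> n - e" using U(3) by (intro degree_le) auto
      show "degree (B + V ^ m') \<le> n - e"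
      proof (intro degree_le allI impI)
        fix i assume "n - e < i"
        then have "coeff (- B - V ^ m') i = 0" using V(3) by simp
        then show "coeff (B + V ^ m') i = 0" by (metis add.right_inverse coeff_add coeff_diff coeff_minus eq_iff_diff_eq_0)
      qed
    qed (use ne3 in simp)
    also have "coeff (A - U ^ m') (n - e) = 0" using U(3) by blast
    also have "coeff (B + V ^ m') (n - e) = - coeff (- B - V ^ m') (n - e)" by simp
    also have "coeff (- B - V ^ m') (n - e) = 0" using V(3) by blast
    also have "(\<lambda>j. (Z j ^ 1 * W \<omega> j) / Z j ^ (n - e) - (poly (A - U ^ m') (Z j) + poly (B + V ^ m') (W \<omega> j)) / Z j ^ (n - e))
       = (\<lambda>j. (?u j ^ m' - ?v j ^ m') / Z j ^ (n - e))"
      using curve[OF w] by (simp add: diff_divide_distrib[symmetric] algebra_simps)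
    also have "\<dots> = (\<lambda>j. (?u j - ?v j) * T j)"
      using m'2 by (simp add: T_def power_diff_eq_mult_sum)
    finally have "(\<lambda>j. (?u j - ?v j) * T j) \<longlonglongrightarrow> 0" by simp
    then have "(\<lambda>j. (?u j - ?v j) * T j / T j) \<longlonglongrightarrow> 0 / (of_nat m' * u ^ (m' - 1))"
      by (intro tendsto_divide T) (use unz m'2 in auto)
    moreover have "eventually (\<lambda>j. T j \<noteq> 0) sequentially"
      using tendsto_imp_eventually_ne[OF T, of 0] unz m'2 by simp
    ultimately show ?thesis
      by (auto elim!: Lim_transform_eventually eventually_mono)
  qed
  moreover have "degree U > 0" using U(2) unz e3 le_degree[of U e] by simp
  ultimately show ?thesis by blast
qed


text \<open>Without such a pair, a power of the slopes is constant only for exponents divisible by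
  \<open>n\<close>. So top terms can cancel on all branches only in such degrees, which rules out
  the representation \<open>PQ\<close>.\<close>

lemma decaying_harmonic:
  assumes "card S \<ge> 3"
    and PQ: "\<And>\<omega> j. \<omega> \<in> S \<Longrightarrow> Z j ^ (n - 1) * W \<omega> j = poly P (Z j) + poly Q (W \<omega> j)"
  shows "\<exists>U V. degree U > 0 \<and> (\<forall>\<omega>\<in>S. (\<lambda>j. poly U (Z j) - poly V (W \<omega> j)) \<longlonglongrightarrow> 0)"
proof (rule ccontr)
  assume no: "\<not> ?thesis"
  have div: "n dvd m" if "\<And>\<omega>. \<omega> \<in> S \<Longrightarrow> \<omega> ^ m = \<kappa>" for m \<kappa>
    using decaying_harmonic_if_power_constant[OF assms(1) that] no by blast
  \<comment> \<open>There are at least three slopes, so no nonzero polynomial of degree at most two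
    vanishes at all of them.\<close>
  have few: "p = 0" if "degree p < 3" "\<And>\<omega>. \<omega> \<in> S \<Longrightarrow> poly p \<omega> = 0" for p :: "complex poly"
  proof (rule ccontr)
    assume "p \<noteq> 0"
    then have "card {x. poly p x = 0} \<le> degree p" "finite {x. poly p x = 0}"
      by (auto simp: card_poly_roots_bound poly_roots_finite)
    moreover have "card S \<le> card {x. poly p x = 0}"
      by (intro card_mono) (use that(2) calculation in auto)
    ultimately show False using assms(1) that(1) by linarith
  qed
  define \<alpha> \<beta> \<rho> where "\<alpha> = lead_coeff A" and "\<beta> = lead_coeff B" and "\<rho> = - \<alpha> / \<beta>"
  have nz: "\<alpha> \<noteq> 0" "\<beta> \<noteq> 0" "\<rho> \<noteq> 0" using lead_nonzero by (auto simp: \<alpha>_def \<beta>_def \<rho>_def)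
  have wn: "\<omega> ^ n = \<rho>" if "\<omega> \<in> S" for \<omega>
    using power_n[OF that] by (simp add: \<alpha>_def \<beta>_def \<rho>_def)
  define M where "M = max n (max (degree P) (degree Q))"
  have dM: "degree P \<le> M" "degree Q \<le> M" "n \<le> M" by (auto simp: M_def)
  have top: "(\<lambda>j. Z j ^ (n - 1) * W \<omega> j / Z j ^ M) \<longlonglongrightarrow> coeff P M + coeff Q M * \<omega> ^ M" if "\<omega> \<in> S" for \<omega>
    using harmonic_tendsto[OF that dM(1,2)] PQ[OF that] by simp
  have "M > n"
  proof (rule ccontr)
    assume "\<not> M > n"
    then have "M = n" using dM by simp
    \<comment> \<open>For \<open>M = n\<close> the limit of the datum would give an affine equation
      satisfied by every slope.\<close>
    have "poly [:coeff P n + coeff Q n * \<rho>, -1:] \<omega> = 0" if "\<omega> \<in> S" for \<omega>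
    proof -
      have "(\<lambda>j. Z j ^ (n - 1) * W \<omega> j / Z j ^ M) \<longlonglongrightarrow> \<omega>"
        using monomial_tendsto[OF that, of "n - 1"] n_ge_3 \<open>M = n\<close> by simp
      then show ?thesis using LIMSEQ_unique[OF top[OF that]] wn[OF that] \<open>M = n\<close> by simp
    qed
    then have "[:coeff P n + coeff Q n * \<rho>, -1:] = 0" by (intro few) auto
    then show False by simp
  qed
  define a b where "a = coeff P M" and "b = coeff Q M"
  have cancel: "a + b * \<omega> ^ M = 0" if "\<omega> \<in> S" for \<omega>
  proof -
    have "(\<lambda>j. Z j ^ (n - 1) * W \<omega> j / Z j ^ M) \<longlonglongrightarrow> 0"
      by (intro monomial_tendsto_0 that) (use \<open>M > n\<close> n_ge_3 in auto)
    then show ?thesis using LIMSEQ_unique[OF top[OF that]] by (simp add: a_def b_def)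
  qed
  obtain \<omega>0 where w0: "\<omega>0 \<in> S" using assms(1) by fastforce
  have wnz: "\<omega> \<noteq> 0" if "\<omega> \<in> S" for \<omega> using that zero_notin_S by auto
  have b: "b \<noteq> 0"
  proof
    assume "b = 0"
    then have "a = 0" using cancel[OF w0] by simp
    then have "degree P < M" "degree Q < M"
      using \<open>b = 0\<close> dM \<open>M > n\<close> by (auto simp: a_def b_def intro!: degree_lessI_coeff)
    then show False using \<open>M > n\<close> by (auto simp: M_def)
  qed
  have "\<omega> ^ M = - a / b" if "\<omega> \<in> S" for \<omega>
    using cancel[OF that] b by (simp add: field_simps eq_neg_iff_add_eq_0)
  then have "n dvd M" by (rule div)
  then obtain k where k: "M = n * k" by (rule dvdE)
  have k2: "k \<ge> 2" using \<open>M > n\<close> k by (cases "k = 0 \<or> k = 1") auto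
  have ab: "a = - b * \<rho> ^ k" using cancel[OF w0] wn[OF w0] k by (simp add: power_mult eq_neg_iff_add_eq_0)
  \<comment> \<open>\<open>c\<close> is fixed by the top coefficient of \<open>P\<close>; by
    \<open>ab\<close>, the same multiple of \<open>A ^ k - (- B) ^ k\<close> also cancels that of
    \<open>Q\<close>.\<close>
  define c where "c = a / \<alpha> ^ k"
  have c: "c \<noteq> 0" using ab b nz by (simp add: c_def)
  have cb: "c * (- \<beta>) ^ k = - b"
  proof -
    have "c * (- \<beta>) ^ k = - b * (\<rho> * - \<beta>) ^ k / \<alpha> ^ k"
      by (simp only: c_def ab power_mult_distrib times_divide_eq_left mult.assoc)
    also have "\<rho> * - \<beta> = \<alpha>" using nz by (simp add: \<rho>_def)
    finally show ?thesis using nz by simp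
  qed
  define P' where "P' = P - smult c (A ^ k)"
  define Q' where "Q' = Q + smult c ((- B) ^ k)"
  have degAk: "degree (A ^ k) \<le> M" "degree ((- B) ^ k) \<le> M"
    using degree_power_le'[of A n k] degree_power_le'[of "- B" n k] degree_A degree_B k by auto
  have degP': "degree P' < M" and degQ': "degree Q' < M"
  proof -
    have "coeff (A ^ k) M = \<alpha> ^ k" "coeff ((- B) ^ k) M = (- \<beta>) ^ k"
      using coeff_power_le_degree[of A n k] coeff_power_le_degree[of "- B" n k] degree_A degree_B k
      by (auto simp: \<alpha>_def \<beta>_def)
    then have z: "coeff P' M = 0" "coeff Q' M = 0"
      using cb nz by (simp_all add: P'_def Q'_def c_def a_def b_def)
    have le: "degree P' \<le> M" "degree Q' \<le> M"
      unfolding P'_def Q'_def using degAk dM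
      by (auto intro!: degree_diff_le degree_add_le order.trans[OF degree_smult_le])
    show "degree P' < M" "degree Q' < M"
      using z le \<open>M > n\<close> by (auto intro!: degree_lessI_coeff)
  qed
  \<comment> \<open>On the curve \<open>A ^ k - (- B) ^ k\<close> is \<open>z w\<close>, of order 2,
    times a cofactor of order \<open>n * (k - 1)\<close>; \<open>J\<close> is the sum of these
    orders.\<close>
  define J where "J = M - n + 2"
  have Jn: "J = n * (k - 1) + 2" using k by (simp add: J_def algebra_simps)
  have nk: "n * (k - 1) \<ge> n" using k2 by (cases k) auto
  define N where "N = max J (max (degree P') (degree Q'))"
  define \<gamma> where "\<gamma> = - c * of_nat k * \<alpha> ^ (k - 1)"
  have \<gamma>: "\<gamma> \<noteq> 0" using c nz k2 by (simp add: \<gamma>_def)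
  define E where "E \<omega> j = poly P' (Z j) + poly Q' (W \<omega> j)" for \<omega> j
  have E: "(\<lambda>j. E \<omega> j / Z j ^ J) \<longlonglongrightarrow> \<gamma> * \<omega>" if w: "\<omega> \<in> S" for \<omega>
  proof -
    let ?a = "\<lambda>j. poly A (Z j)" and ?b = "\<lambda>j. poly (- B) (W \<omega> j)"
    define T where "T j = (\<Sum>i<k. ?a j ^ i * ?b j ^ (k - Suc i)) / Z j ^ (n * (k - 1))" for j
    have "(\<lambda>j. \<Sum>i<k. poly (A ^ i) (Z j) / Z j ^ (n * i) * (poly ((- B) ^ (k - Suc i)) (W \<omega> j) / Z j ^ (n * (k - Suc i))))
        \<longlonglongrightarrow> (\<Sum>i<k. coeff (A ^ i) (n * i) * (coeff ((- B) ^ (k - Suc i)) (n * (k - Suc i)) * \<omega> ^ (n * (k - Suc i))))"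
      by (intro tendsto_intros poly_Z_tendsto poly_W_tendsto degree_power_le' w)
        (use degree_A degree_B in auto)
    also have "(\<Sum>i<k. coeff (A ^ i) (n * i) * (coeff ((- B) ^ (k - Suc i)) (n * (k - Suc i)) * \<omega> ^ (n * (k - Suc i))))
       = (\<Sum>i<k. \<alpha> ^ (k - 1))"
    proof (intro sum.cong refl)
      fix i assume i: "i \<in> {..<k}"
      have ca: "coeff (A ^ i) (n * i) = \<alpha> ^ i"
        using coeff_power_le_degree[of A n i] degree_A by (simp add: \<alpha>_def)
      have cb: "coeff ((- B) ^ l) (n * l) * \<omega> ^ (n * l) = \<alpha> ^ l" for l
      proof -
        have "coeff ((- B) ^ l) (n * l) = (- \<beta>) ^ l"
          using coeff_power_le_degree[of "- B" n l] degree_B by (simp add: \<beta>_def)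
        then have "coeff ((- B) ^ l) (n * l) * \<omega> ^ (n * l) = (- \<beta> * \<rho>) ^ l"
          by (simp only: power_mult wn[OF w] power_mult_distrib)
        also have "- \<beta> * \<rho> = \<alpha>" using nz by (simp add: \<rho>_def)
        finally show ?thesis .
      qed
      show "coeff (A ^ i) (n * i) * (coeff ((- B) ^ (k - Suc i)) (n * (k - Suc i)) * \<omega> ^ (n * (k - Suc i))) = \<alpha> ^ (k - 1)"
        unfolding ca cb using i by (simp flip: power_add)
    qed
    also have "\<dots> = of_nat k * \<alpha> ^ (k - 1)" by simp
    also have "(\<lambda>j. \<Sum>i<k. poly (A ^ i) (Z j) / Z j ^ (n * i) * (poly ((- B) ^ (k - Suc i)) (W \<omega> j) / Z j ^ (n * (k - Suc i)))) = T"
    proof (intro ext)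
      fix j
      have "n * i + n * (k - Suc i) = n * (k - 1)" if "i < k" for i
        using that by (simp flip: distrib_left)
      then show "(\<Sum>i<k. poly (A ^ i) (Z j) / Z j ^ (n * i) * (poly ((- B) ^ (k - Suc i)) (W \<omega> j) / Z j ^ (n * (k - Suc i)))) = T j"
        unfolding T_def sum_divide_distrib
        by (intro sum.cong refl) (simp del: poly_minus flip: power_add)
    qed
    finally have T: "T \<longlonglongrightarrow> of_nat k * \<alpha> ^ (k - 1)" .
    \<comment> \<open>The datum has order \<open>n\<close>, below \<open>J\<close>, so only the
      subtracted multiple contributes to the limit.\<close>
    have "(\<lambda>j. Z j ^ (n - 1) * W \<omega> j / Z j ^ J - c * (Z j ^ 1 * W \<omega> j / Z j ^ Suc 1) * T j)
        \<longlonglongrightarrow> 0 - c * \<omega> * (of_nat k * \<alpha> ^ (k - 1))"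
      by (intro tendsto_intros monomial_tendsto monomial_tendsto_0 T w) (use nk Jn n_ge_3 in linarith)
    moreover have "Z j ^ (n - 1) * W \<omega> j / Z j ^ J - c * (Z j ^ 1 * W \<omega> j / Z j ^ Suc 1) * T j = E \<omega> j / Z j ^ J" for j
    proof -
      have ba: "?a j - ?b j = Z j * W \<omega> j" using curve[OF w, of j] by simp
      have "E \<omega> j = Z j ^ (n - 1) * W \<omega> j - c * (?a j ^ k - ?b j ^ k)"
        using PQ[OF w, of j] by (simp add: E_def P'_def Q'_def algebra_simps)
      also have "?a j ^ k - ?b j ^ k = (Z j * W \<omega> j) * (\<Sum>i<k. ?a j ^ i * ?b j ^ (k - Suc i))"
        using power_diff_eq_mult_sum[of k "?a j" "?b j"] k2 ba by simp
      finally have "E \<omega> j = Z j ^ (n - 1) * W \<omega> j - c * (Z j * W \<omega> j * (\<Sum>i<k. ?a j ^ i * ?b j ^ (k - Suc i)))" .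
      moreover have "Z j ^ J = Z j ^ Suc 1 * Z j ^ (n * (k - 1))"
        unfolding Jn by (simp add: power_add)
      ultimately show ?thesis by (simp add: T_def diff_divide_distrib del: poly_minus)
    qed
    ultimately show ?thesis by (simp add: \<gamma>_def mult_ac)
  qed
  have E': "(\<lambda>j. E \<omega> j / Z j ^ N) \<longlonglongrightarrow> coeff P' N + coeff Q' N * \<omega> ^ N" if "\<omega> \<in> S" for \<omega>
    unfolding E_def by (rule harmonic_tendsto[OF that]) (auto simp: N_def)
  \<comment> \<open>Terms above degree \<open>J\<close> would cancel on all branches, so
    \<open>N\<close> would be a multiple of \<open>n\<close> strictly between
    \<open>n * (k - 1)\<close> and \<open>n * k\<close>.\<close>
  have "N = J"
  proof (rule ccontr)
    assume "N \<noteq> J"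
    then have NJ: "N > J" by (simp add: N_def)
    have cancel': "coeff P' N + coeff Q' N * \<omega> ^ N = 0" if "\<omega> \<in> S" for \<omega>
    proof -
      have "(\<lambda>j. E \<omega> j / Z j ^ J * (1 / Z j ^ (N - J))) \<longlonglongrightarrow> \<gamma> * \<omega> * 0"
        by (intro tendsto_mult E that Z_power_tendsto_0) (use NJ in auto)
      moreover have "Z j ^ J * Z j ^ (N - J) = Z j ^ N" for j
        using NJ by (simp flip: power_add)
      ultimately have "(\<lambda>j. E \<omega> j / Z j ^ N) \<longlonglongrightarrow> 0" by simp
      then show ?thesis using LIMSEQ_unique E'[OF that] by blast
    qed
    have "coeff Q' N \<noteq> 0"
    proof
      assume q: "coeff Q' N = 0"
      then have "coeff P' N = 0" using cancel'[OF w0] by simp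
      moreover have "degree P' \<le> N" "degree Q' \<le> N" by (auto simp: N_def)
      ultimately have "degree P' < N" "degree Q' < N"
        using q NJ by (auto intro!: degree_lessI_coeff)
      then show False using NJ by (auto simp: N_def)
    qed
    then have "\<omega> ^ N = - coeff P' N / coeff Q' N" if "\<omega> \<in> S" for \<omega>
      using cancel'[OF that] by (simp add: field_simps eq_neg_iff_add_eq_0)
    then have "n dvd N" by (rule div)
    then obtain l where l: "N = n * l" by (rule dvdE)
    have "N < M" using NJ degP' degQ' by (auto simp: N_def)
    moreover have "n * (k - 1) < N" using NJ Jn by linarith
    ultimately have "k - 1 < l" "l < k" using n_ge_3 by (simp_all add: l k)
    then show False by linarith
  qed
  \<comment> \<open>\<open>J\<close> exceeds a multiple of \<open>n\<close> by 2, so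
    \<open>\<omega> ^ J\<close> is a constant times the square of \<open>\<omega>\<close>. This
    gives a quadratic with nonzero linear coefficient that vanishes at every slope.\<close>
  have "poly [:coeff P' J, - \<gamma>, coeff Q' J * \<rho> ^ (k - 1):] \<omega> = 0" if "\<omega> \<in> S" for \<omega>
  proof -
    have "\<gamma> * \<omega> = coeff P' J + coeff Q' J * \<omega> ^ J"
      using LIMSEQ_unique[OF E[OF that]] E'[OF that] \<open>N = J\<close> by simp
    also have "\<omega> ^ J = \<rho> ^ (k - 1) * \<omega>\<^sup>2" by (simp add: Jn power_add power_mult wn[OF that] power2_eq_square)
    finally show ?thesis by (simp add: algebra_simps power2_eq_square)
  qed
  then have "[:coeff P' J, - \<gamma>, coeff Q' J * \<rho> ^ (k - 1):] = 0" by (intro few) auto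
  then show False using \<gamma> by simp
qed

end

section \<open>Polynomials in \<open>z\<close> and an independent variable \<open>w\<close>\<close>

abbreviation eval2 :: "complex poly poly \<Rightarrow> complex \<Rightarrow> complex \<Rightarrow> complex" where
  "eval2 F z w \<equiv> poly (poly F [:w:]) z"

lemma poly_map_poly_eval: "poly (map_poly (\<lambda>c. poly c z) F) w = eval2 F z w"
  by (induction F) (auto simp: map_poly_pCons)

lemma eval2_altdef: "eval2 F z w = (\<Sum>b\<le>degree F. poly (coeff F b) z * w ^ b)"
  by (simp add: poly_altdef[of F] poly_sum poly_power)

lemma eval2_dvd: "\<phi> dvd F \<Longrightarrow> eval2 \<phi> z w = 0 \<Longrightarrow> eval2 F z w = 0"
  by (auto elim!: dvdE)

lemma eval2_lift: "eval2 (map_poly (\<lambda>c. [:c:]) B) z w = poly B w"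
  by (induction B) (auto simp: map_poly_pCons)

text \<open>Let \<open>N\<close> be the largest total degree of a term of \<open>R\<close>. Divided
  by \<open>Z ^ N\<close>, \<open>R\<close> tends on the branch of slope \<open>\<omega>\<close> to
  its top homogeneous part at \<open>(1, \<omega>)\<close>. That is a nonzero polynomial in
  \<open>\<omega>\<close> with fewer roots than there are slopes, so \<open>R\<close> has exact
  order \<open>N\<close> on some branch.\<close>

lemma (in curve_branches) degree_coeff_less:
  assumes "degree R < card S" and coeff_R: "coeff R b \<noteq> 0"
    and R: "\<And>\<omega>. \<omega> \<in> S \<Longrightarrow> (\<lambda>j. eval2 R (Z j) (W \<omega> j) / Z j ^ k) \<longlonglongrightarrow> 0"
  shows "degree (coeff R b) + b < k"
proof -
  define I where "I = {b. b \<le> degree R \<and> coeff R b \<noteq> 0}"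
  define N where "N = Max ((\<lambda>b. degree (coeff R b) + b) ` I)"
  have I: "finite I" "b \<in> I" using coeff_R by (auto simp: I_def le_degree)
  then have "N \<in> (\<lambda>b. degree (coeff R b) + b) ` I" unfolding N_def by (intro Max_in) auto
  then obtain b0 where b0: "b0 \<in> I" "N = degree (coeff R b0) + b0" by blast
  have N: "degree (coeff R i) + i \<le> N" if "coeff R i \<noteq> 0" for i
    unfolding N_def using that I by (intro Max_ge) (auto simp: I_def le_degree)
  have "N < k"
  proof (rule ccontr)
    assume "\<not> N < k"
    \<comment> \<open>Coefficients with \<open>i > N\<close> vanish, so the truncated difference
      \<open>N - i\<close> does no harm.\<close>
    define q where "q = (\<Sum>i\<le>degree R. monom (coeff (coeff R i) (N - i)) i)"
    have q: "poly q \<omega> = 0" if w: "\<omega> \<in> S" for \<omega>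
    proof -
      have "(\<lambda>j. \<Sum>i\<le>degree R. poly (coeff R i) (Z j) / Z j ^ (N - i) * (W \<omega> j / Z j) ^ i)
          \<longlonglongrightarrow> (\<Sum>i\<le>degree R. coeff (coeff R i) (N - i) * \<omega> ^ i)"
      proof (intro tendsto_sum tendsto_mult tendsto_power ratio w poly_Z_tendsto)
        fix i
        show "degree (coeff R i) \<le> N - i" using N[of i] by (cases "coeff R i = 0") auto
      qed
      also have "(\<lambda>j. \<Sum>i\<le>degree R. poly (coeff R i) (Z j) / Z j ^ (N - i) * (W \<omega> j / Z j) ^ i)
        = (\<lambda>j. eval2 R (Z j) (W \<omega> j) / Z j ^ N)"
        unfolding eval2_altdef sum_divide_distrib
      proof (intro ext sum.cong refl)
        fix i j
        show "poly (coeff R i) (Z j) / Z j ^ (N - i) * (W \<omega> j / Z j) ^ i = poly (coeff R i) (Z j) * W \<omega> j ^ i / Z j ^ N"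
        proof (cases "coeff R i = 0")
          case False
          then have "Z j ^ N = Z j ^ (N - i) * Z j ^ i" using N[of i] by (simp flip: power_add)
          then show ?thesis by (simp add: power_divide)
        qed simp
      qed
      finally have lim: "(\<lambda>j. eval2 R (Z j) (W \<omega> j) / Z j ^ N) \<longlonglongrightarrow> poly q \<omega>"
        by (simp add: q_def poly_sum poly_monom)
      have "(\<lambda>j. 1 / Z j ^ (N - k)) \<longlonglongrightarrow> coeff 1 (N - k)"
        using poly_Z_tendsto[of 1 "N - k"] by simp
      from tendsto_mult[OF R[OF w] this]
      have "(\<lambda>j. eval2 R (Z j) (W \<omega> j) / (Z j ^ k * Z j ^ (N - k))) \<longlonglongrightarrow> 0" by simp
      moreover have "Z j ^ k * Z j ^ (N - k) = Z j ^ N" for j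
        using \<open>\<not> N < k\<close> by (simp flip: power_add)
      ultimately show ?thesis using LIMSEQ_unique[OF lim] by simp
    qed
    have cq: "coeff q i = (if i \<le> degree R then coeff (coeff R i) (N - i) else 0)" for i
      by (auto simp: q_def coeff_sum)
    have "q \<noteq> 0"
    proof
      assume "q = 0"
      then have "coeff q b0 = 0" by simp
      then show False using b0 by (auto simp: cq I_def)
    qed
    moreover have "degree q \<le> degree R" by (intro degree_le) (simp add: cq)
    moreover have "card S \<le> card {x. poly q x = 0}"
      by (intro card_mono) (use q poly_roots_finite[OF \<open>q \<noteq> 0\<close>] in auto)
    ultimately show False using card_poly_roots_bound[of q] assms(1) by linarith
  qed
  then show ?thesis using N[OF coeff_R] by simp
qed

section \<open>Construction of the branches at infinity\<close>

lemma root_sequence: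
  fixes A B :: "complex poly"
  assumes deg: "degree A = n" "degree B = n" "n \<ge> 3"
    and w: "lead_coeff A + lead_coeff B * \<omega> ^ n = 0"
    and Z: "filterlim Z at_infinity sequentially"
  shows "\<exists>r. (\<lambda>j. r j / Z j) \<longlonglongrightarrow> \<omega> \<and> (\<forall>j::nat. Z j * r j = poly A (Z j) + poly B (r j))"
proof -
  \<comment> \<open>The points of the curve over \<open>Z j\<close> are the roots of
    \<open>p j\<close>. At the trial point \<open>\<omega> * Z j\<close> the value of
    \<open>p j\<close> is of smaller order than \<open>Z j ^ n\<close>, because \<open>w\<close>
    removes the top coefficient; \<open>root_near\<close> then gives a root at a distance of smaller
    order than \<open>Z j\<close>.\<close>
  define p where "p j = B + [:poly A (Z j), - Z j:]" for j
  have dp: "degree (p j) = n" "lead_coeff (p j) = lead_coeff B" for j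
  proof -
    have "degree [:poly A (Z j), - Z j:] < degree B" using deg by (auto intro: le_less_trans[OF degree_pCons_le])
    then show "degree (p j) = n" "lead_coeff (p j) = lead_coeff B"
      using deg unfolding p_def by (simp_all add: degree_add_eq_left lead_coeff_add_le coeff_eq_0)
  qed
  have "\<forall>j. \<exists>r. poly (p j) r = 0 \<and> norm (lead_coeff B) * norm (\<omega> * Z j - r) ^ n \<le> norm (poly (p j) (\<omega> * Z j))"
    using root_near[OF dp(1)] deg(3) unfolding dp(2) by simp
  then obtain r where r: "\<And>j. poly (p j) (r j) = 0"
    "\<And>j. norm (lead_coeff B) * norm (\<omega> * Z j - r j) ^ n \<le> norm (poly (p j) (\<omega> * Z j))"
    by metis
  have lB: "lead_coeff B \<noteq> 0" using deg leading_coeff_0_iff[of B] by force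
  define q where "q = pcompose B [:0, \<omega>:] + A + monom (- \<omega>) 2"
  have q: "poly (p j) (\<omega> * Z j) = poly q (Z j)" for j
    by (simp add: p_def q_def poly_pcompose poly_monom algebra_simps power2_eq_square)
  have cq: "coeff q n = 0"
    using w deg by (simp add: q_def coeff_pcompose_linear add.commute mult.commute)
  have dq: "degree q \<le> n"
    unfolding q_def using deg degree_pcompose_le[of B "[:0, \<omega>:]"]
    by (intro degree_add_le) (auto intro: order.trans[OF degree_monom_le] simp: degree_pCons_eq_if split: if_splits)
  have Znz: "eventually (\<lambda>j. Z j \<noteq> 0) sequentially"
    using Z by (simp add: filterlim_at_infinity_imp_eventually_ne)
  have "(\<lambda>j. norm (poly q (Z j) / Z j ^ n) / norm (lead_coeff B)) \<longlonglongrightarrow> norm (0::complex) / norm (lead_coeff B)"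
    using poly_over_power_tendsto[OF dq Z] lB by (intro tendsto_intros) (auto simp: cq)
  then have lim: "(\<lambda>j. norm (poly q (Z j) / Z j ^ n) / norm (lead_coeff B)) \<longlonglongrightarrow> 0" by simp
  have le: "eventually (\<lambda>j. norm (\<omega> - r j / Z j) ^ n \<le> norm (poly q (Z j) / Z j ^ n) / norm (lead_coeff B)) sequentially"
    using Znz
  proof eventually_elim
    case (elim j)
    have "norm (\<omega> - r j / Z j) = norm (\<omega> * Z j - r j) / norm (Z j)"
      using elim by (simp add: field_simps flip: norm_divide)
    then show ?case using r(2)[of j] elim lB by (simp add: q power_divide norm_divide norm_power field_simps)
  qed
  have "(\<lambda>j. norm (\<omega> - r j / Z j) ^ n) \<longlonglongrightarrow> 0"
    by (rule tendsto_sandwich[OF _ le tendsto_const lim]) simp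
  then have "(\<lambda>j. root n (norm (\<omega> - r j / Z j) ^ n)) \<longlonglongrightarrow> root n 0"
    by (intro tendsto_real_root)
  then have "(\<lambda>j. norm (\<omega> - r j / Z j)) \<longlonglongrightarrow> 0"
    using deg(3) by (simp add: real_root_power_cancel)
  then have "(\<lambda>j. \<omega> - (\<omega> - r j / Z j)) \<longlonglongrightarrow> \<omega> - 0"
    by (intro tendsto_intros) (simp add: tendsto_norm_zero_iff)
  then have "(\<lambda>j. r j / Z j) \<longlonglongrightarrow> \<omega>" by simp
  moreover have "Z j * r j = poly A (Z j) + poly B (r j)" for j
    using r(1)[of j] by (simp add: p_def algebra_simps)
  ultimately show ?thesis by blast
qed

definition curve_poly :: "complex poly \<Rightarrow> complex poly \<Rightarrow> complex poly poly" where
  "curve_poly A B = [:- A, [:0, 1:]:] - map_poly (\<lambda>c. [:c:]) B"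

lemma eval2_curve_poly: "eval2 (curve_poly A B) z w = z * w - poly A z - poly B w"
  by (simp add: curve_poly_def eval2_lift algebra_simps)

text \<open>Beyond the first power, \<open>w\<close> occurs only in \<open>B(w)\<close>, so the
  leading coefficient in \<open>w\<close> is a constant. The same then holds for every factor of the
  curve polynomial.\<close>

lemma curve_poly_degree:
  assumes "degree B \<ge> 3"
  shows "degree (curve_poly A B) = degree B" "lead_coeff (curve_poly A B) = [:- lead_coeff B:]"
proof -
  have c: "coeff (curve_poly A B) i = - [:coeff B i:]" if "i \<ge> 3" for i
    using that by (auto simp: curve_poly_def coeff_map_poly coeff_pCons split: nat.splits)
  show "degree (curve_poly A B) = degree B"
  proof (rule antisym)
    show "degree (curve_poly A B) \<le> degree B"
      using assms by (intro degree_le) (auto simp: c coeff_eq_0)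
    have "coeff (curve_poly A B) (degree B) \<noteq> 0"
      using assms leading_coeff_0_iff[of B] by (auto simp: c)
    then show "degree B \<le> degree (curve_poly A B)" by (rule le_degree)
  qed
  then show "lead_coeff (curve_poly A B) = [:- lead_coeff B:]"
    using assms by (simp add: c)
qed

text \<open>Over a large \<open>Z0 j\<close> the \<open>n\<close> constructed points are distinct,
  since their slopes are. At most \<open>degree \<theta>\<close> of them are zeros of
  \<open>\<theta>\<close>, so at least \<open>degree \<phi>\<close> are zeros of
  \<open>\<phi>\<close>.\<close>

lemma exists_branches:
  assumes deg: "degree A = n" "degree B = n" "n \<ge> 3"
    and \<phi>: "curve_poly A B = \<phi> * \<theta>"
  shows "\<exists>S Z W. curve_branches S Z W n A B \<and> degree \<phi> \<le> card S \<and>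
           (\<forall>\<omega>\<in>S. \<forall>j. eval2 \<phi> (Z j) (W \<omega> j) = 0)"
proof -
  define R where "R = {\<omega>. \<omega> ^ n = - lead_coeff A / lead_coeff B}"
  have lead: "lead_coeff A \<noteq> 0" "lead_coeff B \<noteq> 0"
    using deg leading_coeff_0_iff[of A] leading_coeff_0_iff[of B] by force+
  have cardR: "card R = n" and finR: "finite R" and R0: "0 \<notin> R"
    unfolding R_def using deg(3) lead by (auto simp: card_nth_roots power_0_left)
  define Z0 :: "nat \<Rightarrow> complex" where "Z0 = of_nat"
  have Z0: "filterlim Z0 at_infinity sequentially" unfolding Z0_def by (rule tendsto_of_nat)
  have "\<forall>\<omega>\<in>R. \<exists>r. (\<lambda>j. r j / Z0 j) \<longlonglongrightarrow> \<omega> \<and> (\<forall>j. Z0 j * r j = poly A (Z0 j) + poly B (r j))"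
    using root_sequence[OF deg _ Z0] lead by (auto simp: R_def)
  then obtain r where r: "\<And>\<omega>. \<omega> \<in> R \<Longrightarrow> (\<lambda>j. r \<omega> j / Z0 j) \<longlonglongrightarrow> \<omega>"
    "\<And>\<omega> j. \<omega> \<in> R \<Longrightarrow> Z0 j * r \<omega> j = poly A (Z0 j) + poly B (r \<omega> j)"
    by metis
  have "eventually (\<lambda>j. \<forall>\<omega>\<in>R. \<forall>\<omega>'\<in>R. \<omega> \<noteq> \<omega>' \<longrightarrow> r \<omega> j \<noteq> r \<omega>' j) sequentially"
  proof (intro eventually_ball_finite finR ballI)
    fix \<omega> \<omega>' assume w: "\<omega> \<in> R" "\<omega>' \<in> R"
    show "eventually (\<lambda>j. \<omega> \<noteq> \<omega>' \<longrightarrow> r \<omega> j \<noteq> r \<omega>' j) sequentially"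
    proof (cases "\<omega> = \<omega>'")
      case False
      have "(\<lambda>j. r \<omega> j / Z0 j - r \<omega>' j / Z0 j) \<longlonglongrightarrow> \<omega> - \<omega>'"
        by (intro tendsto_diff r w)
      then have "eventually (\<lambda>j. r \<omega> j / Z0 j - r \<omega>' j / Z0 j \<noteq> 0) sequentially"
        by (rule tendsto_imp_eventually_ne) (use False in auto)
      then show ?thesis by eventually_elim auto
    qed simp
  qed
  then obtain j0 where j0: "\<And>j. j \<ge> j0 \<Longrightarrow> inj_on (\<lambda>\<omega>. r \<omega> j) R"
    by (auto simp: eventually_sequentially inj_on_def)
  define G where "G j = {\<omega>\<in>R. eval2 \<phi> (Z0 j) (r \<omega> j) = 0}" for j
  have nz: "curve_poly A B \<noteq> 0" using curve_poly_degree[of B A] deg by auto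
  have sum_deg: "degree \<phi> + degree \<theta> = n"
    using curve_poly_degree[of B A] deg nz degree_mult_eq[of \<phi> \<theta>] \<phi> by auto
  have cardG: "degree \<phi> \<le> card (G j)" if j: "j \<ge> j0" for j
  proof -
    define q where "q = map_poly (\<lambda>c. poly c (Z0 j)) \<theta>"
    have q: "poly q w = eval2 \<theta> (Z0 j) w" for w by (simp add: q_def poly_map_poly_eval)
    have "q \<noteq> 0"
    proof
      assume "q = 0"
      then have "eval2 (curve_poly A B) (Z0 j) w = 0" for w
        using q[of w] by (simp add: \<phi>)
      then have "poly (B + [:poly A (Z0 j), - Z0 j:]) w = 0" for w
        unfolding eval2_curve_poly by (simp add: algebra_simps)
      then have "B + [:poly A (Z0 j), - Z0 j:] = 0" using poly_all_0_iff_0 by blast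
      then have "coeff (B + [:poly A (Z0 j), - Z0 j:]) n = 0" by simp
      then show False using lead(2) deg by (auto simp: coeff_pCons split: nat.splits)
    qed
    have "card (R - G j) = card ((\<lambda>\<omega>. r \<omega> j) ` (R - G j))"
      by (intro card_image[symmetric] inj_on_subset[OF j0[OF j]]) auto
    also have "\<dots> \<le> card {x. poly q x = 0}"
    proof (intro card_mono poly_roots_finite \<open>q \<noteq> 0\<close> image_subsetI)
      fix \<omega> assume w: "\<omega> \<in> R - G j"
      have "eval2 (curve_poly A B) (Z0 j) (r \<omega> j) = 0"
        using r(2)[of \<omega> j] w by (simp add: eval2_curve_poly)
      then show "r \<omega> j \<in> {x. poly q x = 0}" using w by (auto simp: \<phi> q G_def)
    qed
    also have "\<dots> \<le> degree q" by (rule card_poly_roots_bound) fact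
    also have "\<dots> \<le> degree \<theta>" unfolding q_def by (rule map_poly_degree_leq)
    finally have "card (R - G j) \<le> degree \<theta>" .
    moreover have "card (R - G j) = card R - card (G j)"
      by (intro card_Diff_subset) (auto simp: G_def finR)
    ultimately show ?thesis using sum_deg cardR by linarith
  qed
  \<comment> \<open>Which branches lie on \<open>\<phi> = 0\<close> may depend on \<open>j\<close>.
    Only finitely many sets are possible, so one of them recurs along a subsequence.\<close>
  have "finite (G ` {j0..})" by (rule finite_subset[of _ "Pow R"]) (auto simp: G_def finR)
  then obtain j1 where j1: "j1 \<ge> j0" "infinite {j \<in> {j0..}. G j = G j1}"
    using pigeonhole_infinite[of "{j0..}" G] infinite_Ici by auto
  then obtain s :: "nat \<Rightarrow> nat" where s: "strict_mono s" "\<And>i. G (s i) = G j1"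
    using infinite_enumerate[OF j1(2)] by auto
  have "curve_branches (G j1) (Z0 \<circ> s) (\<lambda>\<omega>. r \<omega> \<circ> s) n A B"
  proof
    show "finite (G j1)" "0 \<notin> G j1" using finR R0 by (auto simp: G_def)
    show "filterlim (Z0 \<circ> s) at_infinity sequentially"
      unfolding comp_def by (rule filterlim_compose[OF Z0 filterlim_subseq[OF s(1)]])
    show "(\<lambda>j. (r \<omega> \<circ> s) j / (Z0 \<circ> s) j) \<longlonglongrightarrow> \<omega>" if "\<omega> \<in> G j1" for \<omega>
      using LIMSEQ_subseq_LIMSEQ[OF r(1) s(1)] that by (auto simp: G_def comp_def)
    show "(Z0 \<circ> s) j * (r \<omega> \<circ> s) j = poly A ((Z0 \<circ> s) j) + poly B ((r \<omega> \<circ> s) j)" if "\<omega> \<in> G j1" for \<omega> j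
      using r(2) that by (auto simp: G_def)
  qed (use deg in auto)
  moreover have "eval2 \<phi> ((Z0 \<circ> s) j) ((r \<omega> \<circ> s) j) = 0" if "\<omega> \<in> G j1" for \<omega> j
    using that s(2)[of j] by (auto simp: G_def)
  ultimately show ?thesis using cardG[OF j1(1)] by blast
qed

section \<open>The ideal of polynomials vanishing on a set without isolated points\<close>

lemma zzbar_poly_add: "zzbar_poly (F + G) z = zzbar_poly F z + zzbar_poly G z"
  and zzbar_poly_smult: "zzbar_poly (smult c F) z = poly c z * zzbar_poly F z"
  by (simp_all add: zzbar_poly_def)

lemma continuous_on_zzbar_poly: "continuous_on T (zzbar_poly F)"
  unfolding zzbar_poly_def eval2_altdef by (intro continuous_intros)

lemma isolated_in_if_finite_nhd:
  fixes \<Gamma> :: "'a::t1_space set"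
  assumes "z \<in> \<Gamma>" "open T" "z \<in> T" "finite (T \<inter> \<Gamma>)"
  shows "z isolated_in \<Gamma>"
proof -
  have "open (T - (T \<inter> \<Gamma> - {z}))" using assms by (intro open_Diff finite_imp_closed) auto
  moreover have "(T - (T \<inter> \<Gamma> - {z})) \<inter> \<Gamma> = {z}" using assms by auto
  ultimately show ?thesis using assms(1) by (auto simp: isolated_in_def)
qed

text \<open>The generator is the primitive part of a nonzero element of least degree in
  \<open>cnj z\<close>. Pseudo-division by it leaves a remainder of smaller degree in the ideal,
  hence 0, and Gauss's lemma removes the multiplier.\<close>

lemma vanishing_ideal_principal:
  fixes \<Gamma> :: "complex set"
  assumes noniso: "\<And>z. \<not> z isolated_in \<Gamma>"
    and \<psi>: "\<psi> \<noteq> 0" "\<And>z. z \<in> \<Gamma> \<Longrightarrow> zzbar_poly \<psi> z = 0"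
  shows "\<exists>\<phi>. (\<forall>z\<in>\<Gamma>. zzbar_poly \<phi> z = 0) \<and> (\<forall>F. (\<forall>z\<in>\<Gamma>. zzbar_poly F z = 0) \<longrightarrow> \<phi> dvd F)"
proof -
  define I where "I = {F. \<forall>z\<in>\<Gamma>. zzbar_poly F z = 0}"
  have "\<exists>p. (p \<in> I \<and> p \<noteq> 0) \<and> (\<forall>q. q \<in> I \<and> q \<noteq> 0 \<longrightarrow> degree p \<le> degree q)"
    by (rule ex_has_least_nat[of "\<lambda>p. p \<in> I \<and> p \<noteq> 0" \<psi> degree]) (use \<psi> in \<open>auto simp: I_def\<close>)
  then obtain p where p: "p \<in> I" "p \<noteq> 0" "\<And>q. q \<in> I \<Longrightarrow> q \<noteq> 0 \<Longrightarrow> degree p \<le> degree q" by blast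
  define \<phi> where "\<phi> = primitive_part p"
  have p_eq: "p = smult (content p) \<phi>" by (simp add: \<phi>_def)
  have c0: "content p \<noteq> 0" using p by simp
  have \<phi>0: "\<phi> \<noteq> 0" "degree \<phi> = degree p" "content \<phi> = 1" using p by (auto simp: \<phi>_def)
  have \<phi>I: "zzbar_poly \<phi> z = 0" if z: "z \<in> \<Gamma>" for z
  proof (rule ccontr)
    assume nz: "zzbar_poly \<phi> z \<noteq> 0"
    \<comment> \<open>Where \<open>\<phi>\<close> is nonzero on \<open>\<Gamma>\<close>, the content
      of \<open>p\<close> must vanish. This happens at finitely many points only, so such a point
      would be isolated.\<close>
    define T where "T = {x. zzbar_poly \<phi> x \<noteq> 0}"
    have "T = zzbar_poly \<phi> -` (- {0})" by (auto simp: T_def)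
    then have "open T" by (simp only:) (intro open_vimage continuous_on_zzbar_poly open_Compl closed_singleton)
    moreover have "T \<inter> \<Gamma> \<subseteq> {x. poly (content p) x = 0}"
    proof
      fix x assume "x \<in> T \<inter> \<Gamma>"
      then have "zzbar_poly p x = 0" "zzbar_poly \<phi> x \<noteq> 0" using p(1) by (auto simp: I_def T_def)
      then show "x \<in> {x. poly (content p) x = 0}"
        using arg_cong[OF p_eq, of "\<lambda>q. zzbar_poly q x"] by (simp add: zzbar_poly_smult)
    qed
    then have "finite (T \<inter> \<Gamma>)" using poly_roots_finite[OF c0] finite_subset by blast
    ultimately have "z isolated_in \<Gamma>" using z nz by (intro isolated_in_if_finite_nhd) (auto simp: T_def)
    then show False using noniso by blast
  qed
  have "\<phi> dvd F" if F: "F \<in> I" for F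
  proof -
    obtain a q where aq: "a \<noteq> 0" "smult a F = \<phi> * q + pseudo_mod F \<phi>"
      using pseudo_mod(1)[OF \<phi>0(1)] by blast
    have "pseudo_mod F \<phi> = smult a F - \<phi> * q" using aq(2) by simp
    then have "zzbar_poly (pseudo_mod F \<phi>) z = 0" if "z \<in> \<Gamma>" for z
      using F \<phi>I[OF that] that by (simp add: I_def zzbar_poly_def)
    then have "pseudo_mod F \<phi> \<in> I" by (simp add: I_def)
    then have "pseudo_mod F \<phi> = 0" using p(3) pseudo_mod(2)[OF \<phi>0(1), of F] \<phi>0(2) by fastforce
    then have "fract_poly \<phi> dvd fract_poly (smult a F)" using aq(2) by (simp add: fract_poly_dvd)
    then have "fract_poly \<phi> dvd smult (to_fract a) (fract_poly F)" by (simp add: fract_poly_smult)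
    then have "fract_poly \<phi> dvd fract_poly F" using aq(1) by (simp add: dvd_smult_iff)
    then show ?thesis using \<phi>0(3) by (rule fract_poly_dvdD)
  qed
  then show ?thesis using \<phi>I by (auto simp: I_def)
qed

section \<open>Polynomial solutions of the Dirichlet problem\<close>

text \<open>The directional derivative in Wirtinger form: when \<open>z\<close> moves along
  \<open>d\<close>, \<open>cnj z\<close> moves along \<open>cnj d\<close>.\<close>

definition dpoly :: "complex \<Rightarrow> complex poly poly \<Rightarrow> complex poly poly" where
  "dpoly d Q = smult [:d:] (map_poly pderiv Q) + smult [:cnj d:] (pderiv Q)"

lemma zzbar_poly_pCons: "zzbar_poly (pCons c Q) z = poly c z + cnj z * zzbar_poly Q z"
  by (simp add: zzbar_poly_def)

lemma dpoly_pCons: "zzbar_poly (dpoly d (pCons c Q)) z =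
    d * poly (pderiv c) z + cnj d * zzbar_poly Q z + cnj z * zzbar_poly (dpoly d Q) z"
  by (simp add: dpoly_def map_poly_pCons pderiv_pCons zzbar_poly_def algebra_simps)

lemma zzbar_poly_has_vector_derivative:
  "((\<lambda>t::real. zzbar_poly Q (z + of_real t * d)) has_vector_derivative
     zzbar_poly (dpoly d Q) (z + of_real t * d)) (at t)"
proof (induction Q)
  case 0
  show ?case by (simp add: dpoly_def zzbar_poly_def)
next
  case (pCons c Q)
  have line: "((\<lambda>t::real. z + of_real t * d) has_vector_derivative d) (at t)"
    by (auto intro!: derivative_eq_intros simp: has_vector_derivative_def scaleR_conv_of_real)
  have cnj: "((\<lambda>t::real. cnj (z + of_real t * d)) has_vector_derivative cnj d) (at t)"
    by (auto intro!: derivative_eq_intros simp: has_vector_derivative_def scaleR_conv_of_real)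
  have "((poly c \<circ> (\<lambda>t::real. z + of_real t * d)) has_vector_derivative d * poly (pderiv c) (z + of_real t * d)) (at t)"
    by (intro field_vector_diff_chain_at line poly_DERIV)
  from has_vector_derivative_add[OF this has_vector_derivative_mult[OF cnj pCons.IH]]
  show ?case unfolding zzbar_poly_pCons dpoly_pCons comp_def
    by (simp add: algebra_simps)
qed

lemma partial_eq_dpoly:
  assumes "open \<Omega>" "\<And>z. z \<in> \<Omega> \<Longrightarrow> u z = zzbar_poly Q z" "z \<in> \<Omega>"
  shows "partial d u z = zzbar_poly (dpoly d Q) z"
proof -
  define T where "T = (\<lambda>t::real. z + of_real t * d) -` \<Omega>"
  have "open T" unfolding T_def by (intro open_vimage assms(1) continuous_intros)
  moreover have "0 \<in> T" using assms(3) by (simp add: T_def)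
  moreover have "zzbar_poly Q (z + of_real t * d) = u (z + of_real t * d)" if "t \<in> T" for t
    using assms(2) that by (simp add: T_def)
  ultimately have "((\<lambda>t::real. u (z + of_real t * d)) has_vector_derivative zzbar_poly (dpoly d Q) z) (at 0)"
    using has_vector_derivative_transform_within_open[OF zzbar_poly_has_vector_derivative[of Q z d 0]] by simp
  then show ?thesis unfolding partial_def by (rule vector_derivative_at)
qed

lemma dpoly_zero_if_vanishing:
  assumes "open \<Omega>" "\<And>z. z \<in> \<Omega> \<Longrightarrow> zzbar_poly F z = 0" "z \<in> \<Omega>"
  shows "zzbar_poly (dpoly d F) z = 0"
proof -
  have "partial d (\<lambda>_. 0) z = zzbar_poly (dpoly d F) z"
    using assms(2) by (intro partial_eq_dpoly[OF assms(1) _ assms(3)]) simp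
  then show ?thesis by (simp add: partial_def)
qed

text \<open>The derivative in \<open>cnj z\<close> combines those in the directions 1 and
  \<open>\<i>\<close>, so it vanishes on the open set too. Induction on the degree in
  \<open>cnj z\<close> leaves a polynomial in \<open>z\<close> with infinitely many zeros.\<close>

lemma zzbar_poly_eq_0_on_open:
  assumes "open \<Omega>" "\<Omega> \<noteq> {}" "\<And>z. z \<in> \<Omega> \<Longrightarrow> zzbar_poly F z = 0"
  shows "F = 0"
  using assms(3)
proof (induction "degree F" arbitrary: F rule: less_induct)
  case less
  have "zzbar_poly (pderiv F) z = 0" if z: "z \<in> \<Omega>" for z
    using dpoly_zero_if_vanishing[OF assms(1) less.prems z, of 1]
      dpoly_zero_if_vanishing[OF assms(1) less.prems z, of \<i>]
    by (simp add: dpoly_def zzbar_poly_add zzbar_poly_smult)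
  then have "degree F = 0"
    using less.hyps[of "pderiv F"] degree_pderiv[of F] pderiv_eq_0_iff[of F] by fastforce
  then obtain c where c: "F = [:c:]" by (rule degree_eq_zeroE)
  have "infinite \<Omega>" using assms(1,2) finite_imp_not_open by blast
  moreover have "\<Omega> \<subseteq> {z. poly c z = 0}" using less.prems by (auto simp: c zzbar_poly_def)
  ultimately have "c = 0" using poly_roots_finite finite_subset by blast
  then show ?case by (simp add: c)
qed

text \<open>The Wirtinger factorisation of the Laplacian. The pure second derivatives drop out
  because the squares of 1 and \<open>\<i>\<close> are opposite.\<close>

lemma dpoly_laplacian: "dpoly 1 (dpoly 1 Q) + dpoly \<i> (dpoly \<i> Q) = smult [:4:] (map_poly pderiv (pderiv Q))"
proof (rule poly_eqI)
  fix k
  have of_nat: "of_nat m * p = smult (of_nat m) p" for m and p :: "complex poly"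
    by (simp add: of_nat_poly)
  have c: "coeff (dpoly d F) k = smult d (pderiv (coeff F k)) + smult (cnj d * of_nat (Suc k)) (coeff F (Suc k))" for d F k
    unfolding dpoly_def coeff_add coeff_smult coeff_pderiv of_nat by (simp add: coeff_map_poly mult.commute)
  define X Y m where "X = pderiv (pderiv (coeff Q k))" and "Y = pderiv (coeff Q (Suc k))"
    and "m = complex_of_nat (Suc k)"
  define T where "T = smult (m * of_nat (Suc (Suc k))) (coeff Q (Suc (Suc k)))"
  have cc: "coeff (dpoly d (dpoly d Q)) k = smult (d * d) X + smult (2 * d * cnj d * m) Y + smult (cnj d * cnj d) T" for d
    unfolding c pderiv_add pderiv_smult X_def[symmetric] Y_def[symmetric] m_def[symmetric]
    by (rule poly_eqI) (simp add: T_def algebra_simps del: of_nat_Suc)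
  have "coeff (smult [:4:] (map_poly pderiv (pderiv Q))) k = smult (4 * m) Y"
    by (simp add: coeff_map_poly coeff_pderiv of_nat pderiv_smult Y_def m_def mult.commute del: of_nat_Suc)
  then show "coeff (dpoly 1 (dpoly 1 Q) + dpoly \<i> (dpoly \<i> Q)) k = coeff (smult [:4:] (map_poly pderiv (pderiv Q))) k"
    unfolding coeff_add cc by (auto intro!: poly_eqI)
qed

lemma zzbar_poly_harmonic:
  assumes "map_poly pderiv (pderiv Q) = 0"
  shows "\<exists>A B. \<forall>z. zzbar_poly Q z = poly A z + poly B (cnj z)"
proof -
  obtain c Q' where Q: "Q = pCons c Q'" by (cases Q)
  define B where "B = map_poly (\<lambda>c. coeff c 0) Q'"
  have "coeff Q' k = [:coeff B k:]" for k
  proof -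
    have "coeff (map_poly pderiv (pderiv Q)) k = 0" using assms by simp
    then have "pderiv (of_nat (Suc k) * coeff Q' k) = 0"
      by (simp add: coeff_map_poly coeff_pderiv Q)
    then have "smult (of_nat (Suc k)) (pderiv (coeff Q' k)) = 0"
      by (simp add: of_nat_poly pderiv_smult del: of_nat_Suc)
    then have "pderiv (coeff Q' k) = 0" by (simp del: of_nat_Suc)
    then have "degree (coeff Q' k) = 0" by (simp add: pderiv_eq_0_iff)
    then show ?thesis by (auto simp: B_def coeff_map_poly elim: degree_eq_zeroE)
  qed
  then have "Q' = map_poly (\<lambda>c. [:c:]) B" by (intro poly_eqI) (simp add: coeff_map_poly)
  then have "zzbar_poly Q z = poly c z + poly (pCons 0 B) (cnj z)" for z
    by (simp add: Q zzbar_poly_pCons) (simp add: zzbar_poly_def eval2_lift)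
  then show ?thesis by blast
qed

text \<open>The passage from analysis to algebra: the formal Laplacian of \<open>Q\<close> vanishes
  on an open set, hence identically, and a polynomial without mixed derivative splits.\<close>

lemma dirichlet_solution_harmonic_data:
  assumes "open \<Omega>" "\<Omega> \<noteq> {}" "dirichlet_solution \<Omega> v u"
    and u: "\<And>z. z \<in> closure \<Omega> \<Longrightarrow> u z = zzbar_poly Q z"
  shows "\<exists>A B. \<forall>z\<in>frontier \<Omega>. v z = poly A z + poly B (cnj z)"
proof -
  have u': "u z = zzbar_poly Q z" if "z \<in> \<Omega>" for z using u that closure_subset by blast
  have "zzbar_poly (smult [:4:] (map_poly pderiv (pderiv Q))) z = 0" if z: "z \<in> \<Omega>" for z
  proof -
    have "partial d (partial d u) z = zzbar_poly (dpoly d (dpoly d Q)) z" for d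
      by (rule partial_eq_dpoly[OF assms(1) _ z]) (rule partial_eq_dpoly[OF assms(1) u'])
    then have "laplacian u z = zzbar_poly (smult [:4:] (map_poly pderiv (pderiv Q))) z"
      by (simp add: laplacian_def zzbar_poly_add flip: dpoly_laplacian)
    then show ?thesis using assms(3) z by (simp add: dirichlet_solution_def)
  qed
  then have "smult [:4:] (map_poly pderiv (pderiv Q)) = 0"
    by (rule zzbar_poly_eq_0_on_open[OF assms(1,2)])
  then have "map_poly pderiv (pderiv Q) = 0" by simp
  then obtain A B where "\<And>z. zzbar_poly Q z = poly A z + poly B (cnj z)"
    using zzbar_poly_harmonic by blast
  moreover have "v z = zzbar_poly Q z" if "z \<in> frontier \<Omega>" for z
    using that assms(3) u[of z] by (auto simp: dirichlet_solution_def frontier_def)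
  ultimately show ?thesis by metis
qed

lemma Re_poly_eq_0_if_frontier:
  assumes "open \<Omega>" "bounded \<Omega>" "\<And>z. z \<in> frontier \<Omega> \<Longrightarrow> Re (poly F z) = 0" "z \<in> \<Omega>"
  shows "Re (poly F z) = 0"
proof (rule antisym)
  show "Re (poly F z) \<le> 0"
    by (rule maximum_real_frontier[of "poly F" \<Omega>]) (use assms in \<open>auto intro!: continuous_intros holomorphic_intros\<close>)
  have "Re (poly (- F) z) \<le> 0"
    by (rule maximum_real_frontier[of "poly (- F)" \<Omega>]) (use assms in \<open>auto intro!: continuous_intros holomorphic_intros\<close>)
  then show "0 \<le> Re (poly F z)" by simp
qed

text \<open>Real and imaginary part are real parts of holomorphic polynomials, so the maximum
  principle makes them vanish inside. Constants can still move between \<open>U\<close> and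
  \<open>V\<close>, hence a conclusion about degrees.\<close>

lemma harmonic_poly_unique:
  assumes \<Omega>: "open \<Omega>" "bounded \<Omega>" "\<Omega> \<noteq> {}"
    and fr: "\<And>z. z \<in> frontier \<Omega> \<Longrightarrow> poly U z + poly V (cnj z) = 0"
  shows "degree U = 0 \<and> degree V = 0"
proof -
  define F where "F = [:U:] + map_poly (\<lambda>c. [:c:]) V"
  have F: "zzbar_poly F z = poly U z + poly V (cnj z)" for z
    by (simp add: F_def zzbar_poly_add) (simp add: zzbar_poly_def eval2_lift)
  have re: "Re (poly U z + poly V (cnj z)) = Re (poly (U + map_poly cnj V) z)" for z by simp
  have im: "Im (poly U z + poly V (cnj z)) = Re (poly (smult (- \<i>) (U - map_poly cnj V)) z)" for z by simp
  have "zzbar_poly F z = 0" if z: "z \<in> \<Omega>" for z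
  proof (rule complex_eqI)
    show "Re (zzbar_poly F z) = Re 0"
      unfolding F re using Re_poly_eq_0_if_frontier[OF \<Omega>(1,2) _ z] fr re by (metis zero_complex.sel(1))
    show "Im (zzbar_poly F z) = Im 0"
      unfolding F im using Re_poly_eq_0_if_frontier[OF \<Omega>(1,2) _ z] fr im by (metis zero_complex.sel(2))
  qed
  then have F0: "F = 0" by (rule zzbar_poly_eq_0_on_open[OF \<Omega>(1,3)])
  have "coeff V k = 0" if "k > 0" for k
    using arg_cong[OF F0, of "\<lambda>F. coeff F k"] that by (auto simp: F_def coeff_map_poly coeff_pCons split: nat.splits)
  then have V: "degree V = 0" by (metis degree_le le_0_eq)
  then obtain v where v: "V = [:v:]" by (rule degree_eq_zeroE)
  have "U + [:v:] = 0" using arg_cong[OF F0, of "\<lambda>F. coeff F 0"] by (simp add: F_def coeff_map_poly v)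
  then have "U = - [:v:]" by (simp only: eq_neg_iff_add_eq_0)
  then show ?thesis using V by simp
qed

section \<open>The degree bound\<close>

text \<open>Pseudo-division multiplies by powers of the leading coefficient. Here these are
  constants, so decay of \<open>F\<close> along branches of \<open>\<phi> = 0\<close> passes to the
  remainder.\<close>

lemma division_by_unit_lead:
  fixes \<phi> :: "complex poly poly"
  assumes "lead_coeff \<phi> = [:c:]" "c \<noteq> 0"
  shows "\<exists>c' q r. c' \<noteq> 0 \<and> smult [:c':] F = \<phi> * q + r \<and> (r = 0 \<or> degree r < degree \<phi>)"
proof -
  have \<phi>0: "\<phi> \<noteq> 0" using assms by auto
  obtain q r where qr: "pseudo_divmod F \<phi> = (q, r)" by (cases "pseudo_divmod F \<phi>")
  have "[:c:] ^ k = [:c ^ k:]" for k by (induction k) auto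
  then show ?thesis
    using pseudo_divmod[OF \<phi>0 qr] assms
    by (intro exI[of _ "c ^ (Suc (degree F) - degree \<phi>)"] exI[of _ q] exI[of _ r]) auto
qed

text \<open>Let \<open>\<phi>\<close> generate the vanishing ideal of \<open>\<Gamma>\<close>. Its
  degrees 0, 1 and 2 in \<open>w\<close> are excluded by hand; from degree 3 on there are enough
  branches for \<open>decaying_harmonic\<close>.\<close>

lemma degree_less_3_of_data:
  fixes \<Gamma> :: "complex set"
  assumes noniso: "\<And>z. \<not> z isolated_in \<Gamma>" and "\<Gamma> \<noteq> {}"
    and uniq: "\<And>U V. (\<And>z. z \<in> \<Gamma> \<Longrightarrow> poly U z + poly V (cnj z) = 0) \<Longrightarrow> degree U = 0 \<and> degree V = 0"
    and AB: "\<And>z. z \<in> \<Gamma> \<Longrightarrow> z * cnj z = poly A z + poly B (cnj z)"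
    and deg: "degree A = n" "degree B = n"
    and PQ: "\<And>z. z \<in> \<Gamma> \<Longrightarrow> z ^ (n - 1) * cnj z = poly P z + poly Q (cnj z)"
  shows "n < 3"
proof (rule ccontr)
  assume "\<not> n < 3"
  then have n: "n \<ge> 3" by simp
  have cd: "degree (curve_poly A B) = n" "lead_coeff (curve_poly A B) = [:- lead_coeff B:]"
    using curve_poly_degree[of B A] deg n by auto
  have c0: "curve_poly A B \<noteq> 0" using cd(1) n by auto
  have cz: "zzbar_poly (curve_poly A B) z = 0" if "z \<in> \<Gamma>" for z
    using AB[OF that] by (simp add: zzbar_poly_def eval2_curve_poly)
  obtain \<phi> where \<phi>: "\<And>z. z \<in> \<Gamma> \<Longrightarrow> zzbar_poly \<phi> z = 0"
    "\<And>F. (\<And>z. z \<in> \<Gamma> \<Longrightarrow> zzbar_poly F z = 0) \<Longrightarrow> \<phi> dvd F"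
    using vanishing_ideal_principal[OF noniso c0 cz] by blast
  obtain \<theta> where \<theta>: "curve_poly A B = \<phi> * \<theta>" using \<phi>(2)[OF cz] by (auto elim: dvdE)
  have lB: "lead_coeff B \<noteq> 0" using deg n leading_coeff_0_iff[of B] by force
  have "lead_coeff \<phi> * lead_coeff \<theta> = [:- lead_coeff B:]"
    using cd(2) by (simp add: \<theta> lead_coeff_mult)
  moreover have "[:- lead_coeff B:] dvd 1" using lB by (simp add: is_unit_const_poly_iff dvd_field_iff)
  ultimately have "lead_coeff \<phi> dvd 1" by (metis dvd_mult_left)
  then obtain c where c: "lead_coeff \<phi> = [:c:]" "c \<noteq> 0"
    by (metis is_unit_poly_iff not_is_unit_0)
  obtain S Z W where br: "curve_branches S Z W n A B" and card: "degree \<phi> \<le> card S"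
    and on: "\<And>\<omega> j. \<omega> \<in> S \<Longrightarrow> eval2 \<phi> (Z j) (W \<omega> j) = 0"
    using exists_branches[OF deg n \<theta>] by blast
  interpret curve_branches S Z W n A B by (rule br)
  have "degree \<phi> \<noteq> 0"
  proof
    assume "degree \<phi> = 0"
    then have "\<phi> = [:[:c:]:]" using c(1) by (metis degree_eq_zeroE lead_coeff_pCons(2))
    then have "zzbar_poly \<phi> z = c" for z by (simp add: zzbar_poly_def)
    then show False using c(2) \<phi>(1) \<open>\<Gamma> \<noteq> {}\<close> by auto
  qed
  moreover have "degree \<phi> \<noteq> 1"
  proof
    assume d: "degree \<phi> = 1"
    have \<phi>_eq: "\<phi> = [:coeff \<phi> 0, [:c:]:]"
      using c(1) by (intro poly_eqI) (auto simp: d coeff_pCons coeff_eq_0 split: nat.splits)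
    have "zzbar_poly \<phi> z = poly (coeff \<phi> 0) z + poly [:0, c:] (cnj z)" for z
      by (subst \<phi>_eq) (simp add: zzbar_poly_def mult.commute)
    then have "degree [:0, c:] = 0" using uniq[of "coeff \<phi> 0" "[:0, c:]"] \<phi>(1) by metis
    then show False using c(2) by simp
  qed
  moreover have "degree \<phi> \<noteq> 2"
  proof
    assume d: "degree \<phi> = 2"
    \<comment> \<open>On the branches \<open>R\<close> is \<open>- c\<close> times the square of
      \<open>w\<close>, of order below 3. So the coefficient of \<open>w\<close> in
      \<open>\<phi>\<close> is affine in \<open>z\<close>.\<close>
    define R where "R = [:coeff \<phi> 0, coeff \<phi> 1:]"
    have \<phi>_eq: "\<phi> = R + monom [:c:] 2"
      using c(1) d unfolding R_def by (intro poly_eqI) (auto simp: coeff_pCons coeff_eq_0 numeral_2_eq_2 split: nat.splits)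
    have "degree (coeff \<phi> 1) \<le> 1"
    proof (cases "coeff \<phi> 1 = 0")
      case False
      have "degree (coeff R 1) + 1 < 3"
      proof (rule degree_coeff_less)
        show "degree R < card S" using card d by (simp add: R_def)
        show "coeff R 1 \<noteq> 0" using False by (simp add: R_def)
        fix \<omega> assume w: "\<omega> \<in> S"
        have "(\<lambda>j. - c * (W \<omega> j / Z j)\<^sup>2 * (1 / Z j ^ 1)) \<longlonglongrightarrow> - c * \<omega>\<^sup>2 * 0"
          by (intro tendsto_intros ratio w Z_power_tendsto_0) simp
        moreover have "eval2 R (Z j) (W \<omega> j) = - c * (W \<omega> j)\<^sup>2" for j
          using on[OF w, of j] by (simp add: \<phi>_eq poly_monom poly_power eq_neg_iff_add_eq_0 del: power2_eq_square)
        ultimately show "(\<lambda>j. eval2 R (Z j) (W \<omega> j) / Z j ^ 3) \<longlonglongrightarrow> 0"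
          by (simp add: power_divide power2_eq_square power3_eq_cube)
      qed
      then show ?thesis by (simp add: R_def)
    qed simp
    then have "coeff \<phi> 1 = [:coeff (coeff \<phi> 1) 0, coeff (coeff \<phi> 1) 1:]"
      by (intro poly_eqI) (auto simp: coeff_pCons coeff_eq_0 split: nat.splits)
    then obtain s t where st: "coeff \<phi> 1 = [:s, t:]" by blast
    have z: "poly (coeff \<phi> 0) z + (s + t * z) * cnj z + c * (cnj z)\<^sup>2 = 0" if "z \<in> \<Gamma>" for z
      using \<phi>(1)[OF that] arg_cong[OF \<phi>_eq, of "\<lambda>F. zzbar_poly F z"] st
      by (simp add: zzbar_poly_def R_def poly_monom poly_power algebra_simps)
    show False
    proof (cases "t = 0")
      case True
      have "poly (coeff \<phi> 0) z + poly [:0, s, c:] (cnj z) = 0" if "z \<in> \<Gamma>" for z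
        using z[OF that] True by (simp add: algebra_simps power2_eq_square)
      then have "degree [:0, s, c:] = 0" using uniq by blast
      then show False using c(2) by simp
    next
      case False
      \<comment> \<open>Replacing \<open>z w\<close> by \<open>A(z) + B(w)\<close> turns the mixed
        term of \<open>\<phi>\<close> into a harmonic one. As \<open>n\<close> exceeds 2, the top
        coefficient of \<open>V\<close> is that of \<open>B\<close>.\<close>
      define V where "V = B + smult (1 / t) [:0, s, c:]"
      have "poly (A + smult (1 / t) (coeff \<phi> 0)) z + poly V (cnj z) = 0" if "z \<in> \<Gamma>" for z
      proof -
        have "t * (poly (A + smult (1 / t) (coeff \<phi> 0)) z + poly V (cnj z))
           = poly (coeff \<phi> 0) z + (s + t * z) * cnj z + c * (cnj z)\<^sup>2"
          using AB[OF that] False by (simp add: V_def algebra_simps power2_eq_square)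
        then show ?thesis using z[OF that] False by simp
      qed
      then have "degree V = 0" using uniq by blast
      then have "coeff V n = 0" using n by (intro coeff_eq_0) simp
      moreover have "coeff [:0, s, c:] n = 0" using n by (intro coeff_eq_0) (simp add: le_less_trans[OF degree_pCons_le])
      ultimately have "coeff B n = 0" by (simp add: V_def del: smult_pCons)
      then show False using lB deg by simp
    qed
  qed
  ultimately have "degree \<phi> \<ge> 3" by linarith
  then have card3: "card S \<ge> 3" using card by simp
  have PQ': "Z j ^ (n - 1) * W \<omega> j = poly P (Z j) + poly Q (W \<omega> j)" if w: "\<omega> \<in> S" for \<omega> j
  proof -
    define F where "F = [:- P, [:0, 1:] ^ (n - 1):] - map_poly (\<lambda>c. [:c:]) Q"
    have F: "eval2 F z w = z ^ (n - 1) * w - poly P z - poly Q w" for z w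
      by (simp add: F_def eval2_lift poly_power algebra_simps)
    \<comment> \<open>Divisibility carries the identity from \<open>\<Gamma>\<close>, where
      \<open>w\<close> is \<open>cnj z\<close>, to the branches, where \<open>w\<close> is
      independent of it.\<close>
    have "\<phi> dvd F" by (intro \<phi>(2)) (simp add: zzbar_poly_def F PQ del: One_nat_def)
    then have "eval2 F (Z j) (W \<omega> j) = 0" using eval2_dvd on[OF w] by blast
    then show ?thesis by (simp add: F algebra_simps)
  qed
  obtain U V where UV: "degree U > 0" "\<And>\<omega>. \<omega> \<in> S \<Longrightarrow> (\<lambda>j. poly U (Z j) - poly V (W \<omega> j)) \<longlonglongrightarrow> 0"
    using decaying_harmonic[OF card3 PQ'] by blast
  define F where "F = [:U:] - map_poly (\<lambda>c. [:c:]) V"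
  have F: "eval2 F z w = poly U z - poly V w" for z w
    by (simp add: F_def eval2_lift)
  obtain c' q r where r: "c' \<noteq> 0" "smult [:c':] F = \<phi> * q + r" "r = 0 \<or> degree r < degree \<phi>"
    using division_by_unit_lead[OF c] by blast
  \<comment> \<open>On the branches the remainder is a constant times a decaying difference, so
    \<open>degree_coeff_less\<close> with \<open>k = 0\<close> leaves it no term. Then
    \<open>\<phi>\<close> divides a multiple of \<open>F\<close>, and \<open>F\<close> vanishes on
    \<open>\<Gamma>\<close>.\<close>
  have "r = 0"
  proof (rule ccontr)
    assume "r \<noteq> 0"
    have "degree (coeff r (degree r)) + degree r < 0"
    proof (rule degree_coeff_less)
      show "degree r < card S" "coeff r (degree r) \<noteq> 0" using r(3) \<open>r \<noteq> 0\<close> card by auto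
      fix \<omega> assume w: "\<omega> \<in> S"
      have "eval2 r (Z j) (W \<omega> j) = c' * (poly U (Z j) - poly V (W \<omega> j))" for j
        using arg_cong[OF r(2), of "\<lambda>F. eval2 F (Z j) (W \<omega> j)"] on[OF w, of j] by (simp add: F)
      then show "(\<lambda>j. eval2 r (Z j) (W \<omega> j) / Z j ^ 0) \<longlonglongrightarrow> 0"
        using tendsto_mult[OF tendsto_const UV(2)[OF w], of c'] by simp
    qed
    then show False by simp
  qed
  have "poly U z + poly (- V) (cnj z) = 0" if "z \<in> \<Gamma>" for z
    using arg_cong[OF r(2), of "\<lambda>F. zzbar_poly F z"] \<phi>(1)[OF that] r(1) F[where z = z and w = "cnj z"] \<open>r = 0\<close>
    by (simp add: zzbar_poly_def)
  then have "degree U = 0" using uniq by blast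
  then show False using UV(1) by simp
qed

section \<open>Conics\<close>

text \<open>The ray is connected and starts in \<open>\<Omega>\<close>; missing the frontier, it
  would stay there, but it is unbounded.\<close>

lemma no_ray_avoiding_frontier:
  fixes \<Omega> :: "'a::real_normed_vector set"
  assumes "bounded \<Omega>" "z \<in> \<Omega>" "v \<noteq> 0" "\<And>s. s \<ge> 0 \<Longrightarrow> z + s *\<^sub>R v \<notin> frontier \<Omega>"
  shows False
proof -
  define L where "L = (\<lambda>s. z + s *\<^sub>R v) ` {0..}"
  have "connected L" unfolding L_def
    by (intro connected_continuous_image continuous_intros convex_connected) auto
  moreover have "z \<in> L" unfolding L_def by (rule image_eqI[of _ _ 0]) auto
  moreover have "L \<inter> frontier \<Omega> = {}" using assms(4) by (auto simp: L_def)
  ultimately have "L \<subseteq> \<Omega>" using connected_Int_frontier[of L \<Omega>] assms(2) by blast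
  then have "bounded L" using assms(1) bounded_subset by blast
  then obtain K where K: "\<And>s. s \<ge> 0 \<Longrightarrow> norm (z + s *\<^sub>R v) \<le> K" by (auto simp: L_def bounded_iff)
  define s where "s = (\<bar>K\<bar> + norm z + 1) / norm v"
  have s: "s \<ge> 0" "norm (s *\<^sub>R v) = \<bar>K\<bar> + norm z + 1" using assms(3) by (auto simp: s_def)
  have "norm (s *\<^sub>R v) \<le> norm (z + s *\<^sub>R v) + norm z" using norm_triangle_ineq4[of "z + s *\<^sub>R v" z] by simp
  then show False using K[OF s(1)] s(2) by linarith
qed

lemma connected_ellipse_region: "connected (ellipse_region c t a b)" if "a > 0" "b > 0"
proof -
  have "ellipse_region c t a b = (\<lambda>z. c + cis t * Complex (a * Re z) (b * Im z)) ` ball 0 1"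
  proof (intro equalityI subsetI)
    fix z assume "z \<in> ellipse_region c t a b"
    then obtain x y where z: "z = c + cis t * Complex x y" "(x / a)\<^sup>2 + (y / b)\<^sup>2 < 1"
      by (auto simp: ellipse_region_def)
    then show "z \<in> (\<lambda>z. c + cis t * Complex (a * Re z) (b * Im z)) ` ball 0 1"
      using that by (intro image_eqI[of _ _ "Complex (x / a) (y / b)"]) (auto simp: cmod_def)
  next
    fix z assume "z \<in> (\<lambda>z. c + cis t * Complex (a * Re z) (b * Im z)) ` ball 0 1"
    then obtain w where w: "norm w < 1" "z = c + cis t * Complex (a * Re w) (b * Im w)" by auto
    then have "(norm w)\<^sup>2 < 1" by (simp add: power_less_one_iff)
    then have "(Re w)\<^sup>2 + (Im w)\<^sup>2 < 1" by (simp add: cmod_power2)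
    then show "z \<in> ellipse_region c t a b"
      unfolding ellipse_region_def mem_Collect_eq w(2)
      by (intro exI[of _ "a * Re w"] exI[of _ "b * Im w"]) (use that in auto)
  qed
  moreover have "connected \<dots>"
    unfolding Complex_eq by (intro connected_continuous_image continuous_intros) auto
  ultimately show ?thesis by simp
qed

text \<open>In rotated coordinates the frontier lies on a conic \<open>f = 0\<close> whose quadratic
  part has eigenvalues \<open>1 - a\<close> and \<open>1 + a\<close>. Rays on which \<open>f\<close>
  keeps its sign would escape without meeting the frontier; excluding them gives
  \<open>f < 0\<close> on \<open>\<Omega>\<close> and \<open>a < 1\<close>.\<close>

lemma is_ellipse_if_frontier_quadratic:
  fixes C :: "complex poly"
  assumes \<Omega>: "open \<Omega>" "\<Omega> \<noteq> {}" "bounded \<Omega>"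
    and C: "degree C \<le> 2" "\<And>z. z \<in> frontier \<Omega> \<Longrightarrow> z * cnj z = of_real (Re (poly C z))"
  shows "is_ellipse \<Omega>"
proof -
  obtain g0 b0 \<alpha> where C_eq: "C = [:g0, b0, \<alpha>:]"
  proof
    show "C = [:coeff C 0, coeff C 1, coeff C 2:]"
      using C(1) by (intro poly_eqI) (auto simp: coeff_pCons coeff_eq_0 numeral_2_eq_2 split: nat.splits)
  qed
  \<comment> \<open>Half the argument, since rotating by \<open>t\<close> multiplies the quadratic
    coefficient by \<open>cis (2 * t)\<close>.\<close>
  define t where "t = - Arg \<alpha> / 2"
  define a where "a = norm \<alpha>"
  have rot: "\<alpha> * (cis t)\<^sup>2 = of_real a"
  proof -
    have "(cis t)\<^sup>2 = cis (- Arg \<alpha>)" unfolding t_def by (subst Complex.DeMoivre) simp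
    moreover have "\<alpha> = of_real a * cis (Arg \<alpha>)" unfolding a_def using rcis_cmod_Arg[of \<alpha>] by (simp add: rcis_def)
    ultimately show ?thesis by (metis (no_types) add.right_inverse cis_mult cis_zero mult.assoc mult.right_neutral)
  qed
  define b c g where "b = Re (b0 * cis t)" and "c = - Im (b0 * cis t)" and "g = Re g0"
  define p where "p x y = cis t * Complex x y" for x y
  define f where "f x y = (1 - a) * x\<^sup>2 + (1 + a) * y\<^sup>2 - b * x - c * y - g" for x y
  have p_inv: "\<exists>x y. z = p x y" for z
  proof -
    have "z = p (Re (cis (- t) * z)) (Im (cis (- t) * z))"
      unfolding p_def complex_surj by (simp add: cis_mult flip: mult.assoc)
    then show ?thesis by blast
  qed
  have p_add: "p x y + s *\<^sub>R p u v = p (x + s * u) (y + s * v)" for x y s u v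
    by (simp add: p_def complex_eq_iff algebra_simps)
  have f0: "f x y = 0" if "p x y \<in> frontier \<Omega>" for x y
  proof -
    have "Re (poly C (p x y)) = Re (g0 + b0 * cis t * Complex x y + \<alpha> * (cis t)\<^sup>2 * (Complex x y)\<^sup>2)"
      by (simp add: C_eq p_def power2_eq_square algebra_simps)
    also have "\<dots> = g + b * x + c * y + a * (x\<^sup>2 - y\<^sup>2)"
      unfolding rot by (simp add: g_def b_def c_def power2_eq_square algebra_simps)
    finally have "Re (poly C (p x y)) = g + b * x + c * y + a * (x\<^sup>2 - y\<^sup>2)" .
    moreover have "p x y * cnj (p x y) = of_real (x\<^sup>2 + y\<^sup>2)"
      by (simp only: complex_norm_square[symmetric]) (simp add: p_def norm_mult cmod_power2)
    ultimately have "complex_of_real (x\<^sup>2 + y\<^sup>2) = of_real (g + b * x + c * y + a * (x\<^sup>2 - y\<^sup>2))"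
      using C(2)[OF that] by simp
    then have "x\<^sup>2 + y\<^sup>2 = g + b * x + c * y + a * (x\<^sup>2 - y\<^sup>2)" by (simp only: of_real_eq_iff)
    then show ?thesis by (simp add: f_def algebra_simps)
  qed
  have p01: "p 0 e \<noteq> 0" "p e 0 \<noteq> 0" if "e \<noteq> 0" for e
    using that by (simp_all add: p_def Complex_eq_0)
  have a0: "a \<ge> 0" by (simp add: a_def)
  \<comment> \<open>The sign of the \<open>y\<close>-derivative of \<open>f\<close>. In this
    direction the linear term does not decrease and the quadratic one has coefficient at least
    1.\<close>
  define E where "E y = (if 2 * (1 + a) * y - c \<ge> 0 then 1 else -1 :: real)" for y
  have E: "E y * (2 * (1 + a) * y - c) \<ge> 0" "(E y)\<^sup>2 = 1" "E y \<noteq> 0" for y by (auto simp: E_def)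
  have f_up: "f x (y + s * E y) \<ge> f x y + s\<^sup>2" if "s \<ge> 0" for x y s
  proof -
    have "f x (y + s * E y) = f x y + s * (E y * (2 * (1 + a) * y - c)) + (1 + a) * (s\<^sup>2 * (E y)\<^sup>2)"
      by (simp add: f_def power2_eq_square algebra_simps)
    moreover have "s * (E y * (2 * (1 + a) * y - c)) \<ge> 0" using E(1) that by simp
    moreover have "a * s\<^sup>2 \<ge> 0" using a0 by simp
    ultimately show ?thesis by (simp add: E(2) algebra_simps)
  qed
  have not_pos: "f x y \<le> 0" if "p x y \<in> \<Omega>" for x y
  proof (rule ccontr)
    assume pos: "\<not> f x y \<le> 0"
    show False
    proof (rule no_ray_avoiding_frontier[OF \<Omega>(3) that])
      show "p 0 (E y) \<noteq> 0" using p01 E(3) by blast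
      fix s :: real assume s: "s \<ge> 0"
      have "f x (y + s * E y) > 0" using f_up[OF s, of x y] pos zero_le_power2[of s] by linarith
      then show "p x y + s *\<^sub>R p 0 (E y) \<notin> frontier \<Omega>" using f0[of x "y + s * E y"] by (auto simp: p_add)
    qed
  qed
  \<comment> \<open>From a zero of \<open>f\<close> in the open set \<open>\<Omega>\<close>, a short
    move along \<open>E y\<close> would stay in \<open>\<Omega>\<close> and make \<open>f\<close>
    positive.\<close>
  have neg: "f x y < 0" if "p x y \<in> \<Omega>" for x y
  proof (rule ccontr)
    assume "\<not> f x y < 0"
    obtain e where e: "e > 0" "ball (p x y) e \<subseteq> \<Omega>" using \<Omega>(1) \<open>p x y \<in> \<Omega>\<close> by (meson open_contains_ball)
    define s where "s = e / 2"
    have "norm (s *\<^sub>R p 0 (E y)) = s * norm (p 0 (E y))"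
      using e(1) by (simp only: norm_scaleR) (simp add: s_def)
    also have "norm (p 0 (E y)) = \<bar>E y\<bar>"
      unfolding p_def norm_mult norm_cis by (simp add: cmod_def)
    also have "\<bar>E y\<bar> = 1" by (simp add: E_def)
    finally have "norm (s *\<^sub>R p 0 (E y)) = s" by simp
    then have "p x y + s *\<^sub>R p 0 (E y) \<in> \<Omega>" using e by (intro subsetD[OF e(2)]) (simp add: dist_norm s_def)
    then have "f x (y + s * E y) \<le> 0" using not_pos by (simp add: p_add)
    moreover have "s > 0" using e by (simp add: s_def)
    then have "s\<^sup>2 > 0" "f x (y + s * E y) \<ge> f x y + s\<^sup>2" using f_up[of s x y] by simp_all
    ultimately show False using \<open>\<not> f x y < 0\<close> by linarith
  qed
  obtain x1 y1 where xy1: "p x1 y1 \<in> \<Omega>" using \<Omega>(2) p_inv by (metis ex_in_conv)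
  have a1: "a < 1"
  proof (rule ccontr)
    assume "\<not> a < 1"
    then have a1: "a \<ge> 1" by simp
    \<comment> \<open>For \<open>a \<ge> 1\<close> the function \<open>f\<close> is concave in
      \<open>x\<close>, so once it starts downhill from a negative value it stays negative.\<close>
    define e where "e = (if 2 * (1 - a) * x1 - b \<ge> 0 then -1 else 1 :: real)"
    have e: "e * (2 * (1 - a) * x1 - b) \<le> 0" "e\<^sup>2 = 1" "e \<noteq> 0" by (auto simp: e_def)
    show False
    proof (rule no_ray_avoiding_frontier[OF \<Omega>(3) xy1])
      show "p e 0 \<noteq> 0" using p01 e(3) by blast
      fix s :: real assume s: "s \<ge> 0"
      have "f (x1 + s * e) y1 = f x1 y1 + s * (e * (2 * (1 - a) * x1 - b)) + (1 - a) * (s\<^sup>2 * e\<^sup>2)"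
        by (simp add: f_def power2_eq_square algebra_simps)
      moreover have "s * (e * (2 * (1 - a) * x1 - b)) \<le> 0" using e(1) s by (simp add: mult_nonneg_nonpos)
      moreover have "(1 - a) * (s\<^sup>2 * e\<^sup>2) \<le> 0" using a1 by (intro mult_nonpos_nonneg) auto
      ultimately have "f (x1 + s * e) y1 < 0" using neg[OF xy1] by linarith
      then show "p x1 y1 + s *\<^sub>R p e 0 \<notin> frontier \<Omega>" using f0[of "x1 + s * e" y1] by (auto simp: p_add)
    qed
  qed
  define x0 y0 where "x0 = b / (2 * (1 - a))" and "y0 = c / (2 * (1 + a))"
  define K where "K = g + (1 - a) * x0\<^sup>2 + (1 + a) * y0\<^sup>2"
  have b: "b = 2 * (1 - a) * x0" and c: "c = 2 * (1 + a) * y0" using a1 a0 by (auto simp: x0_def y0_def)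
  have f_eq: "f x y = (1 - a) * (x - x0)\<^sup>2 + (1 + a) * (y - y0)\<^sup>2 - K" for x y
    unfolding f_def K_def b c by (simp add: power2_eq_square algebra_simps)
  have "(1 - a) * (x1 - x0)\<^sup>2 + (1 + a) * (y1 - y0)\<^sup>2 \<ge> 0" using a1 a0 by simp
  then have K: "K > 0" using neg[OF xy1] f_eq[of x1 y1] by linarith
  define A B where "A = sqrt (K / (1 - a))" and "B = sqrt (K / (1 + a))"
  have AB: "A > 0" "B > 0" "A\<^sup>2 = K / (1 - a)" "B\<^sup>2 = K / (1 + a)" using K a1 a0 by (auto simp: A_def B_def)
  have f_neg: "f x y < 0 \<longleftrightarrow> ((x - x0) / A)\<^sup>2 + ((y - y0) / B)\<^sup>2 < 1" for x y
  proof -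
    have "((x - x0) / A)\<^sup>2 + ((y - y0) / B)\<^sup>2 = ((1 - a) * (x - x0)\<^sup>2 + (1 + a) * (y - y0)\<^sup>2) / K"
      by (simp add: power_divide AB add_divide_distrib mult.commute)
    then show ?thesis using K by (simp add: f_eq)
  qed
  have reg: "ellipse_region (p x0 y0) t A B = {p x y |x y. f x y < 0}" (is "?R = ?F")
  proof (intro equalityI subsetI)
    fix z assume "z \<in> ?R"
    then obtain x y where z: "z = p x0 y0 + cis t * Complex x y" "(x / A)\<^sup>2 + (y / B)\<^sup>2 < 1"
      by (auto simp: ellipse_region_def)
    have "z = p (x0 + x) (y0 + y)" using p_add[of x0 y0 1 x y] z(1) by (simp add: p_def)
    moreover have "f (x0 + x) (y0 + y) < 0" using z(2) by (simp add: f_neg)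
    ultimately show "z \<in> ?F" by blast
  next
    fix z assume "z \<in> ?F"
    then obtain x y where z: "z = p x y" "f x y < 0" by blast
    have "z = p x0 y0 + cis t * Complex (x - x0) (y - y0)"
      using p_add[of x0 y0 1 "x - x0" "y - y0"] z(1) by (simp add: p_def)
    then show "z \<in> ?R" using z(2) unfolding f_neg ellipse_region_def by blast
  qed
  have "\<Omega> \<subseteq> ?R" unfolding reg using neg p_inv by (smt (verit) mem_Collect_eq subsetI)
  \<comment> \<open>The elliptic region is connected, meets \<open>\<Omega>\<close> and misses its
    frontier, so it lies inside \<open>\<Omega>\<close>.\<close>
  moreover have "?R \<inter> frontier \<Omega> = {}" unfolding reg using f0 by fastforce
  then have "?R \<subseteq> \<Omega>"
    using connected_Int_frontier[OF connected_ellipse_region[OF AB(1,2)]] xy1 \<open>\<Omega> \<subseteq> ?R\<close> by blast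
  ultimately show ?thesis unfolding is_ellipse_def using AB(1,2) by blast
qed

section \<open>Reduction to the degree bound and to conics\<close>

theorem theorem1p1:
  fixes \<Omega> :: "complex set"
  assumes "open \<Omega>" and "connected \<Omega>" and "\<Omega> \<noteq> {}" and "bounded \<Omega>"
    and "\<And>z. \<not> z isolated_in frontier \<Omega>"
    and "\<exists>(f :: complex poly fract) (g :: complex poly fract)
            (r :: complex poly fract \<times> complex poly fract).
           \<not> (f = 0 \<and> g = 0 \<and> rat_harm_zero r) \<and>
           (\<forall>z \<in> frontier \<Omega> - (rat_poles f \<union> rat_poles g \<union> rat_harm_poles r).
              (rat_harm_eval r z) ^ 4
              - 2 * (rat_eval f z + cnj (rat_eval g z)) * (rat_harm_eval r z)\<^sup>2
              + (rat_eval f z - cnj (rat_eval g z))\<^sup>2 = 0)"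
  shows "khavinson_shapiro \<Omega>"
  unfolding khavinson_shapiro_def
proof
  assume KS: "\<forall>P. \<exists>u. dirichlet_solution \<Omega> (zzbar_poly P) u \<and>
               (\<exists>Q. \<forall>z\<in>closure \<Omega>. u z = zzbar_poly Q z)"
  have data: "\<exists>A B. \<forall>z\<in>frontier \<Omega>. zzbar_poly P z = poly A z + poly B (cnj z)" for P
    using KS dirichlet_solution_harmonic_data[OF assms(1,3)] by metis
  have "\<Omega> \<noteq> UNIV" using assms(4) by auto
  then have fr: "frontier \<Omega> \<noteq> {}" using assms(3) by (simp add: frontier_eq_empty)
  obtain A0 B0 where AB0: "\<And>z. z \<in> frontier \<Omega> \<Longrightarrow> z * cnj z = poly A0 z + poly B0 (cnj z)"
    using data[of "[:0, [:0, 1:]:]"] by (auto simp: zzbar_poly_def mult.commute)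
  \<comment> \<open>The datum \<open>z * cnj z\<close> is real, so real parts may be taken, and
    \<open>B0\<close> at \<open>cnj z\<close> has the same real part as its conjugate polynomial at
    \<open>z\<close>.\<close>
  define C where "C = A0 + map_poly cnj B0"
  have C: "z * cnj z = of_real (Re (poly C z))" if "z \<in> frontier \<Omega>" for z
  proof -
    have "z * cnj z = of_real (Re (z * cnj z))" by (simp add: complex_eq_iff)
    also have "Re (z * cnj z) = Re (poly C z)" unfolding AB0[OF that] by (simp add: C_def)
    finally show ?thesis .
  qed
  \<comment> \<open>Writing the real part as half the sum of \<open>C(z)\<close> and its conjugate
    gives \<open>A\<close> and \<open>B\<close> the same degree, as the degree bound
    requires.\<close>
  define A where "A = smult (1 / 2) C"
  define B where "B = map_poly cnj A"
  have AB: "z * cnj z = poly A z + poly B (cnj z)" if "z \<in> frontier \<Omega>" for z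
    unfolding C[OF that] by (simp add: A_def B_def complex_eq_iff)
  have "degree B = degree A" unfolding B_def by (rule degree_map_poly) auto
  moreover obtain P Q where PQ: "\<And>z. z \<in> frontier \<Omega> \<Longrightarrow> z ^ (degree A - 1) * cnj z = poly P z + poly Q (cnj z)"
    using data[of "[:0, monom 1 (degree A - 1):]"] by (auto simp: zzbar_poly_def poly_monom mult.commute)
  ultimately have "degree A < 3"
    using degree_less_3_of_data[OF assms(5) fr harmonic_poly_unique[OF assms(1,4,3)] AB refl _ PQ] by blast
  then have "degree C \<le> 2" by (simp add: A_def)
  then show "is_ellipse \<Omega>"
    using is_ellipse_if_frontier_quadratic[OF assms(1,3,4) _ C] by blast
qed

end
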